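(* Let $G$ be a finite simple graph on $n\ge1$ vertices with independence number $\alpha(G)$, and fix an integer $q\ge 1$. Let $G_q$ be the graph obtained from $G$ by attaching $q$ whiskers to each vertex of $G$, and let $R_q=\Bbbk[v : v\in V(G_q)]$. Then $$\deg h_{R_q/I(G_q)}(t)=q\,\alpha(G)\qquad\text{and}\qquad \deg h_{R_q/J(G_q)}(t)=n-2+q\,\alpha(G).$$
   Context: $\Bbbk$ is a field; $R_q$ is a polynomial ring with the standard grading, with variables the vertices of $G_q$. Attaching $q$ whiskers to a vertex $v$ means adding $q$ new vertices, each adjacent only to $v$. For a graph $H$ with vertices as variables, the edge ideal is $I(H)=(uv:\{u,v\}\in E(H))$ and the cover ideal is $J(H)=\bigl(\prod_{v\in C}v : C\text{ a minimal vertex cover of }H\bigr)=\bigcap_{\{u,v\}\in E(H)}(u,v)$. For a standard graded $\Bbbk$-algebra $A$ with Hilbert series $H_A(t)$, the $h$-polynomial $h_A(t)\in\mathbb{Z}[t]$ is the unique polynomial with $H_A(t)=h_A(t)/(1-t)^{\dim A}$. *)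

theory Defs
  imports
    "HOL-Library.Poly_Mapping"
    "HOL-Library.Extended_Nat"
    "HOL-Algebra.Embedded_Algebras"
    "HOL-Algebra.QuotRing"
    "HOL-Computational_Algebra.Polynomial_FPS"
begin

section \<open>Finite simple graphs\<close>

record 'v sgraph =
  verts :: "'v set"
  edges :: "'v set set"

definition finite_simple_graph :: "'v sgraph \<Rightarrow> bool" where
  "finite_simple_graph G \<longleftrightarrow>
     finite (verts G) \<and> (\<forall>e\<in>edges G. e \<subseteq> verts G \<and> card e = 2)"

definition independent_set :: "'v sgraph \<Rightarrow> 'v set \<Rightarrow> bool" where
  "independent_set G S \<longleftrightarrow>
     S \<subseteq> verts G \<and> (\<forall>u\<in>S. \<forall>v\<in>S. {u, v} \<notin> edges G)"

definition independence_number :: "'v sgraph \<Rightarrow> nat" where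
  "independence_number G = Max (card ` {S. independent_set G S})"

definition vertex_cover :: "'v sgraph \<Rightarrow> 'v set \<Rightarrow> bool" where
  "vertex_cover G C \<longleftrightarrow> C \<subseteq> verts G \<and> (\<forall>e\<in>edges G. e \<inter> C \<noteq> {})"

definition minimal_vertex_cover :: "'v sgraph \<Rightarrow> 'v set \<Rightarrow> bool" where
  "minimal_vertex_cover G C \<longleftrightarrow>
     vertex_cover G C \<and> (\<forall>D. D \<subset> C \<longrightarrow> \<not> vertex_cover G D)"

text \<open>The vertices of \<open>G\<close> are tagged \<open>Inl\<close>; \<open>Inr (v, i)\<close>, for \<open>i < q\<close>, is the
  \<open>i\<close>-th whisker vertex attached to \<open>v\<close>.\<close>

definition attach_whiskers :: "nat \<Rightarrow> 'v sgraph \<Rightarrow> ('v + 'v \<times> nat) sgraph" where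
  "attach_whiskers q G =
     \<lparr> verts = Inl ` verts G \<union> Inr ` (verts G \<times> {..<q}),
       edges = (\<lambda>e. Inl ` e) ` edges G
             \<union> {{Inl v, Inr (v, i)} | v i. v \<in> verts G \<and> i < q} \<rparr>"


section \<open>Polynomial rings, edge ideals and cover ideals\<close>

text \<open>A polynomial maps finitely many monomials (exponent vectors of finite support) to nonzero
  coefficients; addition and multiplication are the type class operations of
  \<open>Poly_Mapping\<close>, multiplication being convolution.  As the variables of \<open>poly_ring V\<close> are the
  elements of a set \<open>V\<close>, which need not exhaust its type, it is given as a ring with
  explicit carrier.\<close>

type_synonym ('v, 'k) mpoly = "('v \<Rightarrow>\<^sub>0 nat) \<Rightarrow>\<^sub>0 'k"

definition poly_ring :: "'v set \<Rightarrow> ('v, 'k::field) mpoly ring" where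
  "poly_ring V =
     \<lparr> carrier = {p. \<forall>m\<in>Poly_Mapping.keys p. Poly_Mapping.keys m \<subseteq> V},
       monoid.mult = (*), one = 1, zero = 0, add = (+) \<rparr>"

definition pvar :: "'v \<Rightarrow> ('v, 'k::field) mpoly" where
  "pvar v = Poly_Mapping.single (Poly_Mapping.single v 1) 1"

definition pconst :: "'k \<Rightarrow> ('v, 'k::field) mpoly" where
  "pconst c = Poly_Mapping.single 0 c"

definition homogeneous :: "nat \<Rightarrow> ('v, 'k::field) mpoly \<Rightarrow> bool" where
  "homogeneous d p \<longleftrightarrow>
     (\<forall>m\<in>Poly_Mapping.keys p. (\<Sum>v\<in>Poly_Mapping.keys m. Poly_Mapping.lookup m v) = d)"

definition edge_ideal :: "'v sgraph \<Rightarrow> ('v, 'k::field) mpoly set" where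
  "edge_ideal H =
     genideal (poly_ring (verts H)) {pvar u * pvar v | u v. {u, v} \<in> edges H}"

definition cover_ideal :: "'v sgraph \<Rightarrow> ('v, 'k::field) mpoly set" where
  "cover_ideal H =
     genideal (poly_ring (verts H)) {\<Prod>v\<in>C. pvar v | C. minimal_vertex_cover H C}"


section \<open>Krull dimension, Hilbert series and h-polynomial\<close>

text \<open>The supremum of the lengths \<open>l\<close> of chains \<open>P\<^sub>0 \<subset> \<dots> \<subset> P\<^sub>l\<close> of prime ideals
  (which is 0 for the zero ring).\<close>

definition krull_dim :: "('a, 'b) ring_scheme \<Rightarrow> enat" where
  "krull_dim A =
     Sup {enat l | l. \<exists>P. (\<forall>i\<le>l. primeideal (P i) A) \<and> (\<forall>i<l. P i \<subset> P (Suc i))}"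

text \<open>Here \<open>A\<close> is a ring containing the field \<open>K\<close>, and \<open>gr d\<close> is the homogeneous
  component of \<open>A\<close> of degree \<open>d\<close>.\<close>

definition hilbert_series :: "('a, 'b) ring_scheme \<Rightarrow> 'a set \<Rightarrow> (nat \<Rightarrow> 'a set) \<Rightarrow> int fps" where
  "hilbert_series A K gr = Abs_fps (\<lambda>d. int (ring.dim A K (gr d)))"

text \<open>The equation \<open>H\<^sub>A(t) = h(t) / (1 - t)\<^sup>d\<close> is cleared of its denominator because
  the library has no division for power series over the integers; \<open>1 - t\<close> is a unit there.\<close>

definition h_polynomial :: "('a, 'b) ring_scheme \<Rightarrow> 'a set \<Rightarrow> (nat \<Rightarrow> 'a set) \<Rightarrow> int poly" where
  "h_polynomial A K gr =
     (THE h. hilbert_series A K gr * (1 - fps_X) ^ the_enat (krull_dim A) = fps_of_poly h)"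

text \<open>The \<open>h\<close>-polynomial of \<open>R / I\<close>, where \<open>R\<close> is the polynomial ring in the variables \<open>V\<close>:
  the ground field and the homogeneous components are the images of those of \<open>R\<close>.\<close>

definition h_quot :: "'v set \<Rightarrow> ('v, 'k::field) mpoly set \<Rightarrow> int poly" where
  "h_quot V I =
     (let R = poly_ring V;
          \<pi> = (\<lambda>f. I +>\<^bsub>R\<^esub> f)
      in h_polynomial (R Quot I) (\<pi> ` range pconst)
           (\<lambda>d. \<pi> ` {f \<in> carrier R. homogeneous d f}))"

end

theory Submission
  imports Defs
begin

text \<open>
  The edge ideal and the cover ideal of a graph \<open>H\<close> are the Stanley-Reisner ideals of the complex of
  independent sets and of its Alexander dual, whose faces are the complements of dependent sets.
  For a complex \<open>\<Delta>\<close> with largest face size \<open>d\<close>, the monomials supported on faces are a basis of the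
  quotient ring, and its Krull dimension is \<open>d\<close> (\<open>krull_dim_quot\<close>).  Hence
  \<open>h(t) = \<Sum>\<^sub>F t\<^bsup>card F\<^esup> (1 - t)\<^bsup>d - card F\<^esup>\<close>, where \<open>F\<close> runs over the faces (\<open>h_quot_nonface_ideal\<close>).

  Now let \<open>H\<close> be \<open>G\<close> with \<open>q\<close> whiskers at each of its \<open>n\<close> vertices, and let \<open>N = n + q n\<close>.  An
  independent set of \<open>H\<close> is an independent set \<open>S\<close> of \<open>G\<close> with an arbitrary set of whisker vertices
  away from \<open>S\<close>.  With \<open>s = card S\<close>, the binomial theorem gives
  \<open>\<Sum>\<^sub>F a\<^bsup>card F\<^esup> b\<^bsup>N - card F\<^esup> = \<Sum>\<^sub>S a\<^sup>s b\<^bsup>n - s + q s\<^esup> (a + b)\<^bsup>q (n - s)\<^esup>\<close>, where \<open>F\<close> and \<open>S\<close> run over the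
  independent sets of \<open>H\<close> and of \<open>G\<close> (\<open>independence_polynomial_attach_whiskers\<close>).
  For the edge ideal \<open>d = q n\<close>, and \<open>a = t\<close>, \<open>b = 1 - t\<close> turn the left-hand side into
  \<open>h(t) (1 - t)\<^sup>n\<close>.  For the cover ideal \<open>d = N - 2\<close>, the complement of an edge being a largest face, and
  \<open>a = 1 - t\<close>, \<open>b = t\<close> turn it into \<open>1 - h(t) (1 - t)\<^sup>2\<close>.  On the right-hand side the term of \<open>S\<close> has
  degree \<open>n + q s\<close>, and the terms with \<open>s = \<alpha>(G)\<close> have equal leading coefficients, so the sum has degree
  \<open>n + q \<alpha>(G)\<close> (\<open>degree_sum_bernstein\<close>).  Subtracting \<open>n\<close> and 2 gives the two degrees.

  The dimension is bounded by a count of monomials: a chain of primes of length \<open>l\<close> yields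
  \<open>l\<close> algebraically independent elements of the quotient (\<open>prime_chain_algebraically_independent\<close>),
  so that the number of their power products with exponents at most \<open>s\<close> grows like \<open>s\<^sup>l\<close>, whereas the number of monomials on faces grows only like \<open>s\<^sup>d\<close>.
\<close>

section \<open>The polynomial ring\<close>

lemma keys_plus_nat: "Poly_Mapping.keys (m + m' :: 'v \<Rightarrow>\<^sub>0 nat) = Poly_Mapping.keys m \<union> Poly_Mapping.keys m'"
  by (auto simp: in_keys_iff lookup_add)

lemma keys_mult_elim:
  assumes "m \<in> Poly_Mapping.keys (p * q)"
  obtains a b where "m = a + b" "a \<in> Poly_Mapping.keys p" "b \<in> Poly_Mapping.keys q"
  using keys_mult[of p q] assms by blast

lemma poly_ring_simps [simp]:
  "monoid.mult (poly_ring V) = (*)" "monoid.one (poly_ring V) = 1" "ring.zero (poly_ring V) = 0" "ring.add (poly_ring V) = (+)"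
  by (auto simp: poly_ring_def)

lemma poly_ring_carrier:
  "p \<in> carrier (poly_ring V) \<longleftrightarrow> (\<forall>m\<in>Poly_Mapping.keys p. Poly_Mapping.keys m \<subseteq> V)"
  by (simp add: poly_ring_def)

lemma keys_uminus: "Poly_Mapping.keys (- p :: 'a \<Rightarrow>\<^sub>0 'b::ab_group_add) = Poly_Mapping.keys p"
  by (auto simp: in_keys_iff)

lemma poly_ring_cring: "cring (poly_ring V :: ('v, 'k::field) mpoly ring)"
proof (rule cringI)
  show "abelian_group (poly_ring V :: ('v, 'k) mpoly ring)"
  proof (rule abelian_groupI)
    fix x :: "('v, 'k) mpoly" assume x: "x \<in> carrier (poly_ring V)"
    show "\<exists>y\<in>carrier (poly_ring V). y \<oplus>\<^bsub>poly_ring V\<^esub> x = \<zero>\<^bsub>poly_ring V\<^esub>"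
      using x by (intro bexI[of _ "- x"]) (auto simp: poly_ring_carrier keys_uminus)
  next
    fix x y :: "('v, 'k) mpoly" assume "x \<in> carrier (poly_ring V)" "y \<in> carrier (poly_ring V)"
    then show "x \<oplus>\<^bsub>poly_ring V\<^esub> y \<in> carrier (poly_ring V)"
      using keys_add[of x y] by (auto simp: poly_ring_carrier)
  qed (auto simp: algebra_simps poly_ring_carrier)
  show "Group.comm_monoid (poly_ring V :: ('v, 'k) mpoly ring)"
  proof (rule Group.comm_monoidI)
    fix x y :: "('v, 'k) mpoly" assume "x \<in> carrier (poly_ring V)" "y \<in> carrier (poly_ring V)"
    then show "x \<otimes>\<^bsub>poly_ring V\<^esub> y \<in> carrier (poly_ring V)"
      by (auto simp: poly_ring_carrier keys_plus_nat elim!: keys_mult_elim) blast+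
  qed (auto simp: algebra_simps poly_ring_carrier)
qed (auto simp: algebra_simps)

lemma poly_ring_minus:
  fixes p q :: "('v, 'k::field) mpoly"
  assumes "p \<in> carrier (poly_ring V)" "q \<in> carrier (poly_ring V)"
  shows "p \<ominus>\<^bsub>poly_ring V\<^esub> q = p - q"
proof -
  interpret cring "poly_ring V :: ('v, 'k) mpoly ring" by (rule poly_ring_cring)
  have "\<ominus>\<^bsub>poly_ring V\<^esub> q = - q"
    using assms by (intro minus_equality) (auto simp: poly_ring_carrier keys_uminus)
  then show ?thesis by (simp add: a_minus_def)
qed

lemma poly_mapping_sum_single:
  "p = (\<Sum>m\<in>Poly_Mapping.keys p. Poly_Mapping.single m (Poly_Mapping.lookup p m))"
  by (rule poly_mapping_eqI) (auto simp: lookup_sum lookup_single when_def sum.If_cases in_keys_iff)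

lemma FactRing_zero: "\<zero>\<^bsub>R Quot I\<^esub> = I" and FactRing_one: "\<one>\<^bsub>R Quot I\<^esub> = I +>\<^bsub>R\<^esub> \<one>\<^bsub>R\<^esub>"
  by (simp_all add: FactRing_def)

section \<open>Stanley-Reisner ideals\<close>

text \<open>The Stanley-Reisner ideal \<open>I\<^sub>\<Delta>\<close> of a complex \<open>\<Delta>\<close> on \<open>V\<close>.  Describing it by the supports of its
  monomials, instead of by generators, makes membership a condition on single monomials.\<close>
definition nonface_ideal :: "'v set \<Rightarrow> 'v set set \<Rightarrow> ('v, 'k::field) mpoly set" where
  "nonface_ideal V \<Delta> =
     {p. \<forall>m\<in>Poly_Mapping.keys p. Poly_Mapping.keys m \<subseteq> V \<and> Poly_Mapping.keys m \<notin> \<Delta>}"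

lemma nonface_ideal_subset: "nonface_ideal V \<Delta> \<subseteq> carrier (poly_ring V)"
  by (auto simp: nonface_ideal_def poly_ring_carrier)

lemma ideal_poly_ringI:
  fixes I :: "('v, 'k::field) mpoly set"
  assumes sub: "I \<subseteq> carrier (poly_ring V)" and zero: "0 \<in> I"
    and add: "\<And>p q. p \<in> I \<Longrightarrow> q \<in> I \<Longrightarrow> p + q \<in> I"
    and mult: "\<And>p q. p \<in> carrier (poly_ring V) \<Longrightarrow> q \<in> I \<Longrightarrow> p * q \<in> I"
  shows "ideal I (poly_ring V)"
proof (rule idealI)
  interpret R: cring "poly_ring V :: ('v, 'k) mpoly ring" by (rule poly_ring_cring)
  show "ring (poly_ring V :: ('v, 'k) mpoly ring)" by (rule R.ring_axioms)
  show "subgroup I (add_monoid (poly_ring V))"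
  proof (rule R.add.subgroupI)
    fix p assume p: "p \<in> I"
    have "- 1 * p \<in> I"
      by (rule mult) (use p in \<open>auto simp: poly_ring_carrier keys_uminus\<close>)
    moreover have "\<ominus>\<^bsub>poly_ring V\<^esub> p = - p"
      using subsetD[OF sub p] by (intro R.minus_equality) (auto simp: poly_ring_carrier keys_uminus)
    ultimately show "\<ominus>\<^bsub>poly_ring V\<^esub> p \<in> I" by simp
  qed (use sub zero add in auto)
next
  fix p q :: "('v, 'k) mpoly" assume "p \<in> I" "q \<in> carrier (poly_ring V)"
  then show "q \<otimes>\<^bsub>poly_ring V\<^esub> p \<in> I" "p \<otimes>\<^bsub>poly_ring V\<^esub> q \<in> I"
    using mult[of q p] by (simp_all add: mult.commute[of p q])
qed

locale simplicial_complex =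
  fixes V :: "'v set" and \<Delta> :: "'v set set"
  assumes finite_vertices: "finite V"
    and face_subset: "F \<in> \<Delta> \<Longrightarrow> F \<subseteq> V"
    and empty_face: "{} \<in> \<Delta>"
    and face_mono: "F \<in> \<Delta> \<Longrightarrow> E \<subseteq> F \<Longrightarrow> E \<in> \<Delta>"
begin

lemma nonface_ideal: "ideal (nonface_ideal V \<Delta> :: ('v, 'k::field) mpoly set) (poly_ring V)"
proof (rule ideal_poly_ringI)
  fix p q :: "('v, 'k) mpoly"
  assume "p \<in> carrier (poly_ring V)" "q \<in> nonface_ideal V \<Delta>"
  moreover have "F \<notin> \<Delta> \<Longrightarrow> E \<union> F \<notin> \<Delta>" for E F
    using face_mono[OF _ Un_upper2] by blast
  ultimately show "p * q \<in> nonface_ideal V \<Delta>"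
    by (auto simp: nonface_ideal_def poly_ring_carrier keys_plus_nat elim!: keys_mult_elim) blast+
next
  fix p q :: "('v, 'k) mpoly"
  assume "p \<in> nonface_ideal V \<Delta>" "q \<in> nonface_ideal V \<Delta>"
  then show "p + q \<in> nonface_ideal V \<Delta>"
    using keys_add[of p q] by (auto simp: nonface_ideal_def)
qed (auto simp: nonface_ideal_def poly_ring_carrier)

lemma finite_faces: "finite \<Delta>"
  by (rule finite_subset[of _ "Pow V"]) (use finite_vertices face_subset in auto)

lemma finite_face: "F \<in> \<Delta> \<Longrightarrow> finite F"
  using face_subset finite_vertices finite_subset by blast

end

lemma prod_pvar:
  assumes "finite C"
  shows "(\<Prod>v\<in>C. pvar v :: ('v, 'k::field) mpoly) = Poly_Mapping.single (\<Sum>v\<in>C. Poly_Mapping.single v 1) 1"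
  using assms by (induction C rule: finite_induct) (auto simp: pvar_def mult_single)

lemma lookup_sum_single:
  "finite C \<Longrightarrow> Poly_Mapping.lookup (\<Sum>v\<in>C. Poly_Mapping.single v (1::nat)) u = (if u \<in> C then 1 else 0)"
  by (auto simp: lookup_sum lookup_single when_def)

lemma keys_sum_single:
  assumes "finite C"
  shows "Poly_Mapping.keys (\<Sum>v\<in>C. Poly_Mapping.single v (1::nat)) = C"
  by (rule Set.set_eqI) (simp only: in_keys_iff lookup_sum_single[OF assms], simp)

text \<open>A monomial is divisible by the squarefree monomial of \<open>C\<close> if and only if its support contains \<open>C\<close>.
  So all monomials of a multiple of a generator have nonfaces as supports, and conversely each single
  monomial with such a support is a multiple of a generator.\<close>
lemma genideal_squarefree:
  fixes \<C> :: "'v set set"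
  assumes V: "finite V" and \<C>: "\<And>C. C \<in> \<C> \<Longrightarrow> C \<subseteq> V" "{} \<notin> \<C>"
  defines "\<Delta> \<equiv> {F. F \<subseteq> V \<and> (\<forall>C\<in>\<C>. \<not> C \<subseteq> F)}"
  shows "simplicial_complex V \<Delta>"
    and "genideal (poly_ring V) {\<Prod>v\<in>C. pvar v | C. C \<in> \<C>} = (nonface_ideal V \<Delta> :: ('v, 'k::field) mpoly set)"
proof -
  show cplx: "simplicial_complex V \<Delta>"
    using V \<C>(2) by unfold_locales (auto simp: \<Delta>_def subset_iff, metis subset_empty subsetI, blast)
  interpret simplicial_complex V \<Delta> by (rule cplx)
  interpret R: cring "poly_ring V :: ('v, 'k) mpoly ring" by (rule poly_ring_cring)
  let ?S = "{\<Prod>v\<in>C. pvar v | C. C \<in> \<C>} :: ('v, 'k) mpoly set"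
  let ?J = "genideal (poly_ring V) ?S"
  have finC: "finite C" if "C \<in> \<C>" for C using that \<C> V finite_subset by blast
  have S: "?S \<subseteq> nonface_ideal V \<Delta>"
  proof
    fix p assume "p \<in> ?S"
    then obtain C where C: "C \<in> \<C>" "p = (\<Prod>v\<in>C. pvar v)" by blast
    show "p \<in> nonface_ideal V \<Delta>"
      unfolding C(2) prod_pvar[OF finC[OF C(1)]]
      using C(1) \<C>(1)[OF C(1)] keys_sum_single[OF finC[OF C(1)]]
      by (simp add: nonface_ideal_def \<Delta>_def) blast
  qed
  have Scarr: "?S \<subseteq> carrier (poly_ring V)" using S nonface_ideal_subset by blast
  interpret J: ideal ?J "poly_ring V" by (rule R.genideal_ideal[OF Scarr])
  have "?J \<subseteq> nonface_ideal V \<Delta>"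
    by (rule R.genideal_minimal[OF nonface_ideal S])
  moreover have "p \<in> ?J" if p: "p \<in> nonface_ideal V \<Delta>" for p
  proof -
    have mono: "Poly_Mapping.single m (Poly_Mapping.lookup p m) \<in> ?J" if m: "m \<in> Poly_Mapping.keys p" for m
    proof -
      obtain C where C: "C \<in> \<C>" "C \<subseteq> Poly_Mapping.keys m" and mV: "Poly_Mapping.keys m \<subseteq> V"
        using p m by (auto simp: nonface_ideal_def \<Delta>_def)
      let ?e = "\<Sum>v\<in>C. Poly_Mapping.single v (1::nat)"
      have "Poly_Mapping.lookup m v \<ge> 1" if "v \<in> C" for v
        using C(2) that by (auto simp: in_keys_iff Suc_le_eq)
      then have "Poly_Mapping.lookup m v = Poly_Mapping.lookup (m - ?e + ?e) v" for v
        unfolding lookup_add lookup_minus lookup_sum_single[OF finC[OF C(1)]] by auto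
      then have eq: "m = m - ?e + ?e" by (rule poly_mapping_eqI)
      have "Poly_Mapping.keys (m - ?e) \<subseteq> V"
        using mV by (auto simp: in_keys_iff lookup_minus)
      then have "Poly_Mapping.single (m - ?e) (Poly_Mapping.lookup p m) \<in> carrier (poly_ring V)"
        by (auto simp: poly_ring_carrier)
      moreover have "(\<Prod>v\<in>C. pvar v) \<in> ?J" using C(1) R.genideal_self[OF Scarr] by blast
      ultimately have "Poly_Mapping.single (m - ?e) (Poly_Mapping.lookup p m) * (\<Prod>v\<in>C. pvar v) \<in> ?J"
        using J.I_l_closed by fastforce
      then show ?thesis
        unfolding prod_pvar[OF finC[OF C(1)]] mult_single eq[symmetric] by simp
    qed
    have zero: "0 \<in> ?J" using J.additive_subgroup_axioms additive_subgroup.zero_closed by fastforce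
    have "(\<Sum>m\<in>A. Poly_Mapping.single m (Poly_Mapping.lookup p m)) \<in> ?J"
      if "finite A" "A \<subseteq> Poly_Mapping.keys p" for A
      using that
    proof (induction A rule: finite_induct)
      case (insert m A)
      then show ?case
        using J.a_closed[OF mono[of m], of "\<Sum>m\<in>A. Poly_Mapping.single m (Poly_Mapping.lookup p m)"] by simp
    qed (simp add: zero)
    from this[OF finite_keys subset_refl] show ?thesis
      by (simp only: poly_mapping_sum_single[of p, symmetric])
  qed
  ultimately show "?J = nonface_ideal V \<Delta>" by blast
qed

section \<open>The Hilbert function of a Stanley-Reisner ring\<close>

abbreviation mdeg :: "('v \<Rightarrow>\<^sub>0 nat) \<Rightarrow> nat" where
  "mdeg m \<equiv> \<Sum>v\<in>Poly_Mapping.keys m. Poly_Mapping.lookup m v"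

lemma finite_bounded_monomials:
  assumes "finite F"
  shows "finite {m :: 'v \<Rightarrow>\<^sub>0 nat. Poly_Mapping.keys m \<subseteq> F \<and> (\<forall>v. Poly_Mapping.lookup m v \<le> s)} \<and>
    card {m :: 'v \<Rightarrow>\<^sub>0 nat. Poly_Mapping.keys m \<subseteq> F \<and> (\<forall>v. Poly_Mapping.lookup m v \<le> s)} \<le> (s + 1) ^ card F"
    (is "finite ?M \<and> _")
proof -
  let ?r = "\<lambda>m :: 'v \<Rightarrow>\<^sub>0 nat. restrict (Poly_Mapping.lookup m) F"
  have inj: "inj_on ?r ?M"
  proof (rule inj_onI)
    fix m m' assume m: "m \<in> ?M" "m' \<in> ?M" and eq: "?r m = ?r m'"
    show "m = m'"
    proof (rule poly_mapping_eqI)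
      fix v
      show "Poly_Mapping.lookup m v = Poly_Mapping.lookup m' v"
      proof (cases "v \<in> F")
        case True then show ?thesis using fun_cong[OF eq, of v] by simp
      next
        case False
        then have "v \<notin> Poly_Mapping.keys m" "v \<notin> Poly_Mapping.keys m'" using m by auto
        then show ?thesis by (simp add: in_keys_iff)
      qed
    qed
  qed
  have im: "?r ` ?M \<subseteq> PiE F (\<lambda>_. {..s})" by auto
  have fin: "finite (PiE F (\<lambda>_. {..s}))" using assms by (intro finite_PiE) auto
  have "finite ?M" using finite_imageD[OF finite_subset[OF im fin] inj] .
  moreover have "card ?M \<le> card (PiE F (\<lambda>_. {..s}))" using card_inj_on_le[OF inj im fin] .
  ultimately show ?thesis using assms by (simp add: card_PiE)
qed

lemma lookup_le_mdeg: "Poly_Mapping.lookup m v \<le> mdeg m"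
  by (cases "v \<in> Poly_Mapping.keys m") (auto intro: member_le_sum simp: in_keys_iff)

context simplicial_complex
begin

definition standard_monomials :: "nat \<Rightarrow> ('v \<Rightarrow>\<^sub>0 nat) set" where
  "standard_monomials d = {m. Poly_Mapping.keys m \<in> \<Delta> \<and> mdeg m = d}"

lemma finite_standard_monomials: "finite (standard_monomials d)"
  by (rule finite_subset[OF _ conjunct1[OF finite_bounded_monomials[OF finite_vertices, of d]]])
    (auto simp: standard_monomials_def lookup_le_mdeg dest: face_subset)

lemma coset_eq_iff:
  fixes p q :: "('v, 'k::field) mpoly"
  assumes "p \<in> carrier (poly_ring V)" "q \<in> carrier (poly_ring V)"
  shows "nonface_ideal V \<Delta> +>\<^bsub>poly_ring V\<^esub> p = nonface_ideal V \<Delta> +>\<^bsub>poly_ring V\<^esub> q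
    \<longleftrightarrow> p - q \<in> nonface_ideal V \<Delta>"
  using ring.quotient_eq_iff_same_a_r_cos[OF cring.axioms(1)[OF poly_ring_cring] nonface_ideal assms]
  by (simp add: poly_ring_minus[OF assms])

text \<open>The monomials on faces are a basis of the quotient: modulo \<open>I\<^sub>\<Delta>\<close> no combination of them vanishes, as
  a polynomial lies in \<open>I\<^sub>\<Delta>\<close> only if all of its monomials do.\<close>
lemma dimension_standard:
  fixes S :: "('v \<Rightarrow>\<^sub>0 nat) set"
  defines "I \<equiv> nonface_ideal V \<Delta> :: ('v, 'k::field) mpoly set"
  defines "R \<equiv> poly_ring V :: ('v, 'k) mpoly ring"
  assumes "finite S" "\<And>m. m \<in> S \<Longrightarrow> Poly_Mapping.keys m \<in> \<Delta>"
  shows "ring.dimension (R Quot I) (card S) ((+>\<^bsub>R\<^esub>) I ` range pconst)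
     ((+>\<^bsub>R\<^esub>) I ` {p. Poly_Mapping.keys p \<subseteq> S})"
proof -
  interpret R: cring R unfolding R_def by (rule poly_ring_cring)
  interpret I: ideal I R unfolding I_def R_def by (rule nonface_ideal)
  interpret A: ring "R Quot I" by (rule I.quotient_is_ring)
  let ?\<pi> = "(+>\<^bsub>R\<^esub>) I" and ?K = "(+>\<^bsub>R\<^esub>) I ` range pconst"
  interpret h: ring_hom_ring R "R Quot I" ?\<pi> by (rule I.rcos_ring_hom_ring)
  have const: "pconst c \<in> carrier R" for c
    by (auto simp: R_def pconst_def poly_ring_carrier)
  show ?thesis using assms(3,4)
  proof (induction S rule: finite_induct)
    case empty
    have zero: "\<zero>\<^bsub>R Quot I\<^esub> = ?\<pi> 0"
      unfolding FactRing_zero by (rule I.a_rcos_const[symmetric]) (simp add: I_def nonface_ideal_def)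
    have "{p :: ('v, 'k) mpoly. Poly_Mapping.keys p \<subseteq> {}} = {0}"
      by simp
    then have "?\<pi> ` {p. Poly_Mapping.keys p \<subseteq> {}} = {\<zero>\<^bsub>R Quot I\<^esub>}"
      unfolding zero by (simp only: image_empty image_insert)
    with A.zero_dim[of ?K] show ?case by (simp only: card.empty)
  next
    case (insert m S)
    let ?E = "?\<pi> ` {p. Poly_Mapping.keys p \<subseteq> S}"
    let ?m = "Poly_Mapping.single m (1::'k)"
    have carrS: "p \<in> carrier R" if "Poly_Mapping.keys p \<subseteq> insert m S" for p
      using that insert.prems face_subset by (fastforce simp: R_def poly_ring_carrier)
    have mR: "?m \<in> carrier R" by (rule carrS) simp
    have "?\<pi> ?m \<notin> ?E"
    proof
      assume "?\<pi> ?m \<in> ?E"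
      then obtain p where p: "Poly_Mapping.keys p \<subseteq> S" "?\<pi> ?m = ?\<pi> p" by blast
      then have "?m - p \<in> I"
        using coset_eq_iff[of ?m p] mR carrS[of p] by (auto simp: R_def I_def)
      moreover have "m \<in> Poly_Mapping.keys (?m - p)"
      proof -
        have "Poly_Mapping.lookup p m = 0" using p(1) insert.hyps(2) by (auto simp flip: not_in_keys_iff_lookup_eq_zero)
        then show ?thesis by (simp add: in_keys_iff lookup_minus)
      qed
      ultimately show False using insert.prems by (auto simp: I_def nonface_ideal_def)
    qed
    moreover have "A.line_extension ?K (?\<pi> ?m) ?E = ?\<pi> ` {p. Poly_Mapping.keys p \<subseteq> insert m S}"
    proof -
      have step: "?\<pi> (pconst c) \<otimes>\<^bsub>R Quot I\<^esub> ?\<pi> ?m \<oplus>\<^bsub>R Quot I\<^esub> ?\<pi> p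
          = ?\<pi> (Poly_Mapping.single m c + p)" if "Poly_Mapping.keys p \<subseteq> S" for c p
      proof -
        have "?\<pi> (pconst c \<otimes>\<^bsub>R\<^esub> ?m \<oplus>\<^bsub>R\<^esub> p) = ?\<pi> (pconst c) \<otimes>\<^bsub>R Quot I\<^esub> ?\<pi> ?m \<oplus>\<^bsub>R Quot I\<^esub> ?\<pi> p"
          using const[of c] mR carrS[of p] that by (metis R.m_closed h.hom_add h.hom_mult subset_insertI2)
        then show ?thesis by (simp add: R_def pconst_def mult_single)
      qed
      have "?\<pi> q \<in> A.line_extension ?K (?\<pi> ?m) ?E" if q: "Poly_Mapping.keys q \<subseteq> insert m S" for q
      proof -
        let ?c = "Poly_Mapping.lookup q m"
        let ?p = "q - Poly_Mapping.single m ?c"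
        have "Poly_Mapping.keys ?p \<subseteq> S"
        proof
          fix x assume x: "x \<in> Poly_Mapping.keys ?p"
          then have "x \<noteq> m" by (auto simp: in_keys_iff lookup_minus)
          then show "x \<in> S" using x q by (auto simp: in_keys_iff lookup_minus lookup_single)
        qed
        then show ?thesis
          using step[of ?p ?c]
          unfolding A.line_extension_def set_add_def' r_coset_def
          by auto
      qed
      moreover have "x \<in> ?\<pi> ` {p. Poly_Mapping.keys p \<subseteq> insert m S}"
        if x: "x \<in> A.line_extension ?K (?\<pi> ?m) ?E" for x
      proof -
        obtain c p where "Poly_Mapping.keys p \<subseteq> S" "x = ?\<pi> (Poly_Mapping.single m c + p)"
          using x step unfolding A.line_extension_def set_add_def' r_coset_def by auto
        moreover from this(1) have "Poly_Mapping.keys (Poly_Mapping.single m c + p) \<subseteq> insert m S"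
          using keys_add[of "Poly_Mapping.single m c" p] by (auto split: if_splits)
        ultimately show ?thesis by blast
      qed
      ultimately show ?thesis by blast
    qed
    ultimately show ?case
      using A.Suc_dim[OF _ _ insert.IH, of "?\<pi> ?m"] insert.prems insert.hyps mR by simp
  qed
qed

lemma hilbert_function:
  defines "I \<equiv> nonface_ideal V \<Delta> :: ('v, 'k::field) mpoly set"
  defines "R \<equiv> poly_ring V :: ('v, 'k) mpoly ring"
  shows "ring.dim (R Quot I) ((+>\<^bsub>R\<^esub>) I ` range pconst) ((+>\<^bsub>R\<^esub>) I ` {p \<in> carrier R. homogeneous d p})
    = card (standard_monomials d)"
proof -
  interpret R: cring R unfolding R_def by (rule poly_ring_cring)
  interpret I: ideal I R unfolding I_def R_def by (rule nonface_ideal)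
  interpret A: ring "R Quot I" by (rule I.quotient_is_ring)
  let ?\<pi> = "(+>\<^bsub>R\<^esub>) I" and ?K = "(+>\<^bsub>R\<^esub>) I ` range pconst"
  interpret h: ring_hom_ring R "R Quot I" ?\<pi> by (rule I.rcos_ring_hom_ring)
  have const: "pconst c \<in> carrier R" for c
    by (auto simp: R_def pconst_def poly_ring_carrier)
  have subr: "subring (range pconst) R"
  proof (rule R.subringI)
    show "\<one>\<^bsub>R\<^esub> \<in> range pconst" by (auto simp: R_def pconst_def intro!: image_eqI[of _ _ 1])
  next
    fix x y assume "x \<in> range (pconst :: 'k \<Rightarrow> ('v,'k) mpoly)" "y \<in> range (pconst :: 'k \<Rightarrow> ('v,'k) mpoly)"
    then obtain a b where ab: "x = pconst a" "y = pconst b" by auto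
    then have "x \<otimes>\<^bsub>R\<^esub> y = pconst (a * b)" "x \<oplus>\<^bsub>R\<^esub> y = pconst (a + b)"
      by (auto simp: R_def pconst_def mult_single single_add)
    then show "x \<otimes>\<^bsub>R\<^esub> y \<in> range pconst" "x \<oplus>\<^bsub>R\<^esub> y \<in> range pconst" by blast+
  next
    fix x assume "x \<in> range (pconst :: 'k \<Rightarrow> ('v,'k) mpoly)"
    then obtain a where a: "x = pconst a" by auto
    have "\<ominus>\<^bsub>R\<^esub> x = pconst (- a)"
      using const a by (intro R.minus_equality) (auto simp: R_def pconst_def single_add[symmetric])
    then show "\<ominus>\<^bsub>R\<^esub> x \<in> range pconst" by auto
  qed (use const in auto)
  have "subfield (range pconst) R"
  proof (rule R.subfieldI)
    show "subcring (range pconst) R"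
      by (rule R.subcringI[OF subr]) (auto simp: R_def mult.commute)
    have "\<exists>b. b * a = (1 :: 'k) \<and> a * b = 1" if "a \<noteq> 0" for a :: 'k
      using that by (intro exI[of _ "inverse a"]) auto
    then have "\<exists>b. pconst b * pconst a = (1 :: ('v, 'k) mpoly) \<and> pconst a * pconst b = (1 :: ('v, 'k) mpoly)" if "a \<noteq> 0" for a :: 'k
      using that unfolding pconst_def mult_single by (metis add_0 single_one)
    then have "pconst a \<in> Units (R \<lparr>carrier := range pconst\<rparr>)" if "a \<noteq> 0" for a :: 'k
      using that by (auto simp: Units_def R_def)
    moreover have "0 \<notin> Units (R \<lparr>carrier := range pconst\<rparr>)"
      by (auto simp: Units_def R_def)
    moreover have "x \<in> range pconst" if "x \<in> Units (R \<lparr>carrier := range pconst\<rparr>)" for x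
      using that by (simp add: Units_def)
    moreover have "\<zero>\<^bsub>R\<^esub> = 0" "pconst 0 = (0 :: ('v, 'k) mpoly)" by (simp_all add: R_def pconst_def)
    ultimately show "Units (R \<lparr>carrier := range pconst\<rparr>) = range pconst - {\<zero>\<^bsub>R\<^esub>}"
      by (intro equalityI subsetI) (auto, metis)
  qed
  moreover have "\<one>\<^bsub>R Quot I\<^esub> \<noteq> \<zero>\<^bsub>R Quot I\<^esub>"
  proof
    assume "\<one>\<^bsub>R Quot I\<^esub> = \<zero>\<^bsub>R Quot I\<^esub>"
    then have "I +>\<^bsub>R\<^esub> \<one>\<^bsub>R\<^esub> = I" by (simp only: FactRing_zero FactRing_one)
    then have "(1 :: ('v, 'k) mpoly) \<in> I"
      using I.a_rcos_self[of "\<one>\<^bsub>R\<^esub>"] R.one_closed by (simp add: R_def)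
    then show False using empty_face by (simp add: I_def nonface_ideal_def)
  qed
  ultimately have K: "subfield ?K (R Quot I)" by (rule h.img_is_subfield)
  have "?\<pi> ` {p. Poly_Mapping.keys p \<subseteq> standard_monomials d} = ?\<pi> ` {p \<in> carrier R. homogeneous d p}"
  proof (intro equalityI subsetI)
    fix x assume "x \<in> ?\<pi> ` {p. Poly_Mapping.keys p \<subseteq> standard_monomials d}"
    then obtain p where p: "Poly_Mapping.keys p \<subseteq> standard_monomials d" "x = ?\<pi> p" by blast
    then have "p \<in> carrier R" "homogeneous d p"
      using face_subset
      by (fastforce simp: R_def poly_ring_carrier homogeneous_def standard_monomials_def)+
    then show "x \<in> ?\<pi> ` {p \<in> carrier R. homogeneous d p}" using p(2) by blast
  next
    fix x assume "x \<in> ?\<pi> ` {p \<in> carrier R. homogeneous d p}"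
    then obtain p where p: "p \<in> carrier R" "homogeneous d p" "x = ?\<pi> p" by blast
    define q where "q = (\<Sum>m\<in>Poly_Mapping.keys p \<inter> standard_monomials d.
      Poly_Mapping.single m (Poly_Mapping.lookup p m))"
    have q: "Poly_Mapping.lookup q m = (if m \<in> standard_monomials d then Poly_Mapping.lookup p m else 0)" for m
      by (auto simp: q_def lookup_sum lookup_single when_def sum.If_cases in_keys_iff)
    then have kq: "Poly_Mapping.keys q \<subseteq> Poly_Mapping.keys p \<inter> standard_monomials d"
      by (auto simp: in_keys_iff split: if_splits)
    have "p - q \<in> I"
      using p(1,2) by (auto simp: I_def R_def nonface_ideal_def poly_ring_carrier homogeneous_def
          in_keys_iff[of _ "p - q"] lookup_minus q in_keys_iff[of _ p] standard_monomials_def split: if_splits)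
    moreover have "q \<in> carrier R" using p(1) kq by (auto simp: R_def poly_ring_carrier)
    ultimately have "x = ?\<pi> q" using coset_eq_iff[of p q] p by (simp add: R_def I_def)
    then show "x \<in> ?\<pi> ` {p. Poly_Mapping.keys p \<subseteq> standard_monomials d}" using kq by blast
  qed
  moreover have "A.dimension (card (standard_monomials d)) ?K (?\<pi> ` {p. Poly_Mapping.keys p \<subseteq> standard_monomials d})"
    unfolding R_def I_def
    by (rule dimension_standard[OF finite_standard_monomials]) (simp add: standard_monomials_def)
  ultimately show ?thesis using A.dimI[OF K] by (simp add: over_def)
qed

end

section \<open>The Hilbert series of a Stanley-Reisner ring\<close>

lemma mdeg_superset:
  assumes "finite F" "Poly_Mapping.keys m \<subseteq> F"
  shows "mdeg m = (\<Sum>v\<in>F. Poly_Mapping.lookup m v)"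
  using assms by (intro sum.mono_neutral_left) (auto simp: in_keys_iff)

lemma mdeg_plus: "mdeg (m + m') = mdeg m + mdeg m'"
  by (simp add: keys_plus_nat lookup_add sum.distrib
      mdeg_superset[of "Poly_Mapping.keys m \<union> Poly_Mapping.keys m'" m]
      mdeg_superset[of "Poly_Mapping.keys m \<union> Poly_Mapping.keys m'" m'])

definition full_support :: "'v set \<Rightarrow> nat \<Rightarrow> ('v \<Rightarrow>\<^sub>0 nat) set" where
  "full_support F d = {m. Poly_Mapping.keys m = F \<and> mdeg m = d}"

lemma finite_full_support: "finite F \<Longrightarrow> finite (full_support F d)"
  by (rule finite_subset[OF _ conjunct1[OF finite_bounded_monomials[of F d]]])
    (auto simp: full_support_def lookup_le_mdeg)

text \<open>Lowering the exponent of \<open>v\<close> by one either keeps \<open>v\<close> in the support or removes it.  This is the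
  recursion \<open>f = t (f + g)\<close> of the generating functions for the supports \<open>insert v F\<close> and \<open>F\<close>.\<close>
lemma full_support_insert:
  assumes "v \<notin> F"
  shows "full_support (insert v F) (Suc d) =
    (\<lambda>m. m + Poly_Mapping.single v 1) ` (full_support (insert v F) d \<union> full_support F d)"
    (is "?L = ?f ` _")
proof (intro equalityI subsetI)
  fix m assume m: "m \<in> ?L"
  let ?m = "m - Poly_Mapping.single v 1"
  have v: "Poly_Mapping.lookup m v \<noteq> 0"
    using m in_keys_iff[of v m] by (simp add: full_support_def)
  have eq: "m = ?f ?m"
    using v by (intro poly_mapping_eqI) (auto simp: lookup_add lookup_minus lookup_single when_def)
  have "mdeg m = mdeg ?m + 1" using arg_cong[OF eq, of mdeg] by (simp add: mdeg_plus)
  moreover have "Poly_Mapping.keys ?m = insert v F \<or> Poly_Mapping.keys ?m = F"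
  proof -
    have "Poly_Mapping.keys m = Poly_Mapping.keys ?m \<union> {v}" by (subst eq, subst keys_plus_nat) simp
    then show ?thesis using m assms by (auto simp: full_support_def)
  qed
  ultimately have "?m \<in> full_support (insert v F) d \<union> full_support F d"
    using m by (auto simp: full_support_def)
  then show "m \<in> ?f ` (full_support (insert v F) d \<union> full_support F d)" using eq by blast
next
  fix m' assume "m' \<in> ?f ` (full_support (insert v F) d \<union> full_support F d)"
  then obtain m where m: "m \<in> full_support (insert v F) d \<union> full_support F d" and m': "m' = ?f m"
    by blast
  have "mdeg (?f m) = mdeg m + 1" by (simp only: mdeg_plus) simp
  moreover have "Poly_Mapping.keys (?f m) = insert v (Poly_Mapping.keys m)" by (simp add: keys_plus_nat)
  ultimately show "m' \<in> ?L" using m unfolding m' full_support_def by auto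
qed

lemma full_support_series:
  assumes "finite F"
  shows "Abs_fps (\<lambda>d. int (card (full_support F d))) * (1 - fps_X) ^ card F = fps_X ^ card F"
  using assms
proof (induction F rule: finite_induct)
  case empty
  have "full_support ({} :: 'a set) d = (if d = 0 then {0} else {})" for d
    by (auto simp: full_support_def)
  then have "Abs_fps (\<lambda>d. int (card (full_support ({} :: 'a set) d))) = 1"
    by (intro fps_ext) simp
  then show ?case by simp
next
  case (insert v F)
  let ?s = "\<lambda>F. Abs_fps (\<lambda>d. int (card (full_support F d)))"
  have rec: "?s (insert v F) = fps_X * (?s (insert v F) + ?s F)"
  proof (rule fps_ext)
    fix d
    show "fps_nth (?s (insert v F)) d = fps_nth (fps_X * (?s (insert v F) + ?s F)) d"
    proof (cases d)
      case 0
      have "full_support (insert v F) 0 = {}"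
        using in_keys_iff[of v] by (auto simp: full_support_def)
      then show ?thesis using 0 by simp
    next
      case (Suc k)
      have "full_support (insert v F) k \<inter> full_support F k = {}"
        using insert.hyps by (auto simp: full_support_def)
      then have "card (full_support (insert v F) (Suc k)) = card (full_support (insert v F) k) + card (full_support F k)"
        unfolding full_support_insert[OF insert.hyps(2)]
        by (subst card_image) (auto simp: finite_full_support insert.hyps inj_on_def card_Un_disjoint)
      then show ?thesis using Suc by simp
    qed
  qed
  have "?s (insert v F) * (1 - fps_X) = fps_X * ?s F"
  proof -
    have "f * (1 - x) = x * g" if "f = x * (f + g)" for f g x :: "int fps"
    proof -
      have "f = x * f + x * g" using that by (simp only: distrib_left)
      then have "f - x * f = x * g" by (metis add_diff_cancel_left')
      then show ?thesis by (simp only: right_diff_distrib mult_1_right mult.commute[of f x])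
    qed
    from this[OF rec] show ?thesis .
  qed
  then have "?s (insert v F) * (1 - fps_X) ^ card (insert v F) = fps_X * (?s F * (1 - fps_X) ^ card F)"
    using insert.hyps by (simp add: mult_ac)
  then show ?case using insert by simp
qed

context simplicial_complex
begin

text \<open>The monomials outside \<open>I\<^sub>\<Delta>\<close> are sorted by their support, which may be any face \<open>F\<close> and contributes
  \<open>(t / (1 - t))\<^bsup>card F\<^esup>\<close>.\<close>
lemma standard_monomials_series:
  assumes "\<And>F. F \<in> \<Delta> \<Longrightarrow> card F \<le> d"
  shows "Abs_fps (\<lambda>k. int (card (standard_monomials k))) * (1 - fps_X) ^ d
    = (\<Sum>F\<in>\<Delta>. fps_X ^ card F * (1 - fps_X) ^ (d - card F))"
proof -
  have "standard_monomials k = (\<Union>F\<in>\<Delta>. full_support F k)" for k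
    by (auto simp: standard_monomials_def full_support_def)
  moreover have "card (\<Union>F\<in>\<Delta>. full_support F k) = (\<Sum>F\<in>\<Delta>. card (full_support F k))" for k
    using finite_faces finite_face
    by (intro card_UN_disjoint) (auto simp: finite_full_support, auto simp: full_support_def)
  ultimately have "Abs_fps (\<lambda>k. int (card (standard_monomials k)))
      = (\<Sum>F\<in>\<Delta>. Abs_fps (\<lambda>k. int (card (full_support F k))))"
    by (intro fps_ext) (simp add: fps_sum_nth)
  then have "Abs_fps (\<lambda>k. int (card (standard_monomials k))) * (1 - fps_X) ^ d
      = (\<Sum>F\<in>\<Delta>. Abs_fps (\<lambda>k. int (card (full_support F k))) * (1 - fps_X) ^ d)"
    by (simp add: sum_distrib_right)
  also have "\<dots> = (\<Sum>F\<in>\<Delta>. fps_X ^ card F * (1 - fps_X) ^ (d - card F))"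
  proof (rule sum.cong[OF refl])
    fix F assume F: "F \<in> \<Delta>"
    have "(1 - fps_X :: int fps) ^ d = (1 - fps_X) ^ card F * (1 - fps_X) ^ (d - card F)"
      using assms[OF F] by (metis le_add_diff_inverse power_add)
    then show "Abs_fps (\<lambda>k. int (card (full_support F k))) * (1 - fps_X) ^ d
        = fps_X ^ card F * (1 - fps_X) ^ (d - card F)"
      using full_support_series[OF finite_face[OF F]] by (simp only: mult.assoc[symmetric])
  qed
  finally show ?thesis .
qed

end

section \<open>Two tools for finite sets of monomials\<close>

text \<open>Gaussian elimination: an equation with a nonzero coefficient removes itself and one unknown, so the
  excess of unknowns over equations persists until no equation is left.\<close>
lemma nontrivial_solution:
  fixes M :: "'t \<Rightarrow> 'b \<Rightarrow> 'k::field"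
  assumes "finite T" "finite B" "card T < card B"
  shows "\<exists>c. (\<exists>b\<in>B. c b \<noteq> 0) \<and> (\<forall>t\<in>T. (\<Sum>b\<in>B. c b * M t b) = 0)"
  using assms
proof (induction T arbitrary: M B rule: finite_induct)
  case empty
  then have "B \<noteq> {}" by auto
  then show ?case by (intro exI[of _ "\<lambda>_. 1"]) auto
next
  case (insert t T)
  show ?case
  proof (cases "\<forall>b\<in>B. M t b = 0")
    case True
    have "card T < card B" using insert by simp
    from insert.IH[OF insert.prems(1) this, of M] obtain c
      where c: "\<exists>b\<in>B. c b \<noteq> 0" "\<forall>t\<in>T. (\<Sum>b\<in>B. c b * M t b) = 0" by blast
    show ?thesis by (rule exI[of _ c]) (use c True in \<open>auto\<close>)
  next
    case False
    then obtain b0 where b0: "b0 \<in> B" "M t b0 \<noteq> 0" by blast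
    let ?B = "B - {b0}"
    define M' where "M' u b = M u b - M u b0 * (M t b / M t b0)" for u b
    have "card T < card ?B" using insert b0 by simp
    then obtain c where c: "\<exists>b\<in>?B. c b \<noteq> 0" "\<forall>u\<in>T. (\<Sum>b\<in>?B. c b * M' u b) = 0"
      using insert.IH[of ?B M'] insert.prems(1) by auto
    define s where "s = (\<Sum>b\<in>?B. c b * M t b) / M t b0"
    define c' where "c' = c(b0 := - s)"
    have split: "(\<Sum>b\<in>B. c' b * M u b) = (\<Sum>b\<in>?B. c b * M u b) - s * M u b0" for u
      using insert.prems(1) b0(1) by (subst sum.remove[of _ b0]) (auto simp: c'_def intro!: sum.cong)
    have "(\<Sum>b\<in>B. c' b * M u b) = 0" if u: "u \<in> insert t T" for u
    proof (cases "u = t")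
      case True then show ?thesis unfolding split using b0(2) by (simp add: s_def)
    next
      case False
      have "(\<Sum>b\<in>?B. c b * M' u b) = (\<Sum>b\<in>?B. c b * M u b) - s * M u b0"
        by (simp add: M'_def s_def algebra_simps sum_subtractf sum_distrib_left sum_divide_distrib)
      then show ?thesis unfolding split using c(2) u False by auto
    qed
    moreover have "\<exists>b\<in>B. c' b \<noteq> 0" using c(1) by (auto simp: c'_def)
    ultimately show ?thesis by blast
  qed
qed

text \<open>Reading the exponents as digits to large bases gives a linear weight that is injective on a given
  finite set of exponent vectors.\<close>
lemma separating_weight:
  fixes A :: "('v \<Rightarrow> nat) set"
  assumes "finite V" "finite A"
  shows "\<exists>w :: 'v \<Rightarrow> nat. \<forall>m\<in>A. \<forall>m'\<in>A. (\<Sum>v\<in>V. w v * m v) = (\<Sum>v\<in>V. w v * m' v) \<longrightarrow> (\<forall>v\<in>V. m v = m' v)"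
  using assms(1)
proof (induction V rule: finite_induct)
  case (insert x V)
  then obtain w :: "'v \<Rightarrow> nat" where w: "\<forall>m\<in>A. \<forall>m'\<in>A. (\<Sum>v\<in>V. w v * m v) = (\<Sum>v\<in>V. w v * m' v) \<longrightarrow> (\<forall>v\<in>V. m v = m' v)"
    by blast
  define B where "B = Suc (\<Sum>m\<in>A. m x)"
  have B: "m x < B" if "m \<in> A" for m
    unfolding B_def using member_le_sum[OF that, of "\<lambda>m. m x"] assms(2) by simp
  \<comment> \<open>The new exponent becomes the lowest digit to base \<open>B\<close>.\<close>
  define w' where "w' v = (if v = x then 1 else B * w v)" for v
  have w': "(\<Sum>v\<in>insert x V. w' v * m v) = m x + B * (\<Sum>v\<in>V. w v * m v)" for m :: "'v \<Rightarrow> nat"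
    using insert.hyps by (auto simp: w'_def sum_distrib_left mult.assoc intro!: sum.cong)
  have "\<forall>v\<in>insert x V. m v = m' v"
    if m: "m \<in> A" "m' \<in> A" and eq: "(\<Sum>v\<in>insert x V. w' v * m v) = (\<Sum>v\<in>insert x V. w' v * m' v)" for m m'
  proof -
    have e: "m x + B * (\<Sum>v\<in>V. w v * m v) = m' x + B * (\<Sum>v\<in>V. w v * m' v)"
      using eq unfolding w' .
    have "m x = m' x" using arg_cong[OF e, of "\<lambda>k. k mod B"] B[OF m(1)] B[OF m(2)] by simp
    moreover have "(\<Sum>v\<in>V. w v * m v) = (\<Sum>v\<in>V. w v * m' v)"
      using e \<open>m x = m' x\<close> B[OF m(1)] by simp
    ultimately show ?thesis using w m by blast
  qed
  then show ?case by blast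
qed simp

section \<open>Prime ideals of quotients of polynomial rings\<close>

lemma lookup_mult_keys:
  fixes p q :: "'a::comm_monoid_add \<Rightarrow>\<^sub>0 'b::comm_semiring_1"
  shows "Poly_Mapping.lookup (p * q) k
    = (\<Sum>l\<in>Poly_Mapping.keys p. \<Sum>r\<in>Poly_Mapping.keys q.
        Poly_Mapping.lookup p l * Poly_Mapping.lookup q r when k = l + r)"
proof -
  have "p * q = (\<Sum>l\<in>Poly_Mapping.keys p. Poly_Mapping.single l (Poly_Mapping.lookup p l)) *
      (\<Sum>r\<in>Poly_Mapping.keys q. Poly_Mapping.single r (Poly_Mapping.lookup q r))"
    by (simp only: poly_mapping_sum_single[symmetric])
  also have "\<dots> = (\<Sum>l\<in>Poly_Mapping.keys p. \<Sum>r\<in>Poly_Mapping.keys q.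
      Poly_Mapping.single (l + r) (Poly_Mapping.lookup p l * Poly_Mapping.lookup q r))"
    by (simp add: sum_product mult_single)
  finally show ?thesis by (simp add: lookup_sum lookup_single eq_commute[of k])
qed

lemma simplex_complex: "finite V \<Longrightarrow> F \<subseteq> V \<Longrightarrow> simplicial_complex V (Pow F)"
  by unfold_locales auto

text \<open>The quotient by this ideal is the polynomial ring in the variables of \<open>F\<close>, so the point is that
  a polynomial ring is a domain.  Two polynomials with a monomial supported in \<open>F\<close> each have such
  monomials of largest weight, for a weight that tells their exponent vectors apart; the product of
  the two can then not cancel.  The weight replaces a monomial order, so that the variables need not
  be ordered.\<close>
lemma nonface_ideal_simplex_prime:
  assumes V: "finite V" and F: "F \<subseteq> V"
  shows "primeideal (nonface_ideal V (Pow F) :: ('v, 'k::field) mpoly set) (poly_ring V)"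
proof -
  let ?P = "nonface_ideal V (Pow F) :: ('v, 'k) mpoly set"
  interpret simplicial_complex V "Pow F" using simplex_complex[OF assms] .
  have prime: "p \<in> ?P \<or> q \<in> ?P"
    if p: "p \<in> carrier (poly_ring V)" and q: "q \<in> carrier (poly_ring V)" and pq: "p * q \<in> ?P"
    for p q :: "('v, 'k) mpoly"
  proof (rule ccontr)
    assume neg: "\<not> (p \<in> ?P \<or> q \<in> ?P)"
    define K where "K = (\<lambda>p :: ('v, 'k) mpoly. {m \<in> Poly_Mapping.keys p. Poly_Mapping.keys m \<subseteq> F})"
    have fin: "finite (K p)" "finite (K q)" by (auto simp: K_def)
    have "K p \<noteq> {}" "K q \<noteq> {}"
      using neg p q by (auto simp: nonface_ideal_def poly_ring_carrier K_def)
    obtain w :: "'v \<Rightarrow> nat" where w: "\<forall>m\<in>Poly_Mapping.lookup ` (K p \<union> K q). \<forall>m'\<in>Poly_Mapping.lookup ` (K p \<union> K q).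
        (\<Sum>v\<in>V. w v * m v) = (\<Sum>v\<in>V. w v * m' v) \<longrightarrow> (\<forall>v\<in>V. m v = m' v)"
      using separating_weight[OF V, of "Poly_Mapping.lookup ` (K p \<union> K q)"] fin by auto
    define W where "W m = (\<Sum>v\<in>V. w v * Poly_Mapping.lookup m v)" for m
    have W_add: "W (a + b) = W a + W b" for a b
      by (simp add: W_def lookup_add algebra_simps sum.distrib)
    have W_inj: "a = b" if "a \<in> K p \<union> K q" "b \<in> K p \<union> K q" "W a = W b" for a b
    proof (rule poly_mapping_eqI)
      fix v
      have "\<forall>v\<in>V. Poly_Mapping.lookup a v = Poly_Mapping.lookup b v"
        using w that unfolding W_def by blast
      moreover have "Poly_Mapping.lookup a v = 0 \<and> Poly_Mapping.lookup b v = 0" if "v \<notin> V"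
        using that \<open>a \<in> _\<close> \<open>b \<in> _\<close> F by (auto simp: K_def simp flip: not_in_keys_iff_lookup_eq_zero)
      ultimately show "Poly_Mapping.lookup a v = Poly_Mapping.lookup b v" by metis
    qed
    obtain a where a: "a \<in> K p" "\<And>m. m \<in> K p \<Longrightarrow> W m \<le> W a"
      using Max_in[of "W ` K p"] Max_ge[of "W ` K p"] fin \<open>K p \<noteq> {}\<close> by fastforce
    obtain b where b: "b \<in> K q" "\<And>m. m \<in> K q \<Longrightarrow> W m \<le> W b"
      using Max_in[of "W ` K q"] Max_ge[of "W ` K q"] fin \<open>K q \<noteq> {}\<close> by fastforce
    have F_ab: "Poly_Mapping.keys (a + b) \<subseteq> F"
      using a(1) b(1) by (auto simp: K_def keys_plus_nat)
    have uniq: "l = a \<and> r = b"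
      if "l \<in> Poly_Mapping.keys p" "r \<in> Poly_Mapping.keys q" and eq: "a + b = l + r" for l r
    proof -
      have lr: "l \<in> K p" "r \<in> K q" using that F_ab unfolding eq by (auto simp: K_def keys_plus_nat)
      moreover have "W a + W b = W l + W r" using eq W_add by metis
      ultimately have "W l = W a" "W r = W b" using a(2)[of l] b(2)[of r] by auto
      then show ?thesis using W_inj lr a(1) b(1) by blast
    qed
    have "Poly_Mapping.lookup (p * q) (a + b)
        = (\<Sum>l\<in>Poly_Mapping.keys p. \<Sum>r\<in>Poly_Mapping.keys q.
            Poly_Mapping.lookup p l * Poly_Mapping.lookup q r when a + b = l + r)"
      by (rule lookup_mult_keys)
    also have "\<dots> = (\<Sum>l\<in>Poly_Mapping.keys p. \<Sum>r\<in>Poly_Mapping.keys q.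
        if l = a \<and> r = b then Poly_Mapping.lookup p a * Poly_Mapping.lookup q b else 0)"
      using uniq by (intro sum.cong) (auto simp: when_def)
    also have "\<dots> = Poly_Mapping.lookup p a * Poly_Mapping.lookup q b"
    proof -
      have "(\<Sum>r\<in>Poly_Mapping.keys q. if l = a \<and> r = b then Poly_Mapping.lookup p a * Poly_Mapping.lookup q b else 0)
        = (if l = a then Poly_Mapping.lookup p a * Poly_Mapping.lookup q b else 0)" for l
        using b(1) by (cases "l = a") (auto simp: K_def)
      then show ?thesis using a(1) by (simp add: K_def)
    qed
    also have "\<dots> \<noteq> 0" using a(1) b(1) by (auto simp: K_def in_keys_iff)
    finally have "a + b \<in> Poly_Mapping.keys (p * q)" by (simp add: in_keys_iff)
    then show False using pq F_ab by (auto simp: nonface_ideal_def)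
  qed
  show ?thesis
  proof (rule primeidealI[OF nonface_ideal poly_ring_cring])
    have "1 \<in> carrier (poly_ring V) - ?P" by (auto simp: nonface_ideal_def poly_ring_carrier)
    then show "carrier (poly_ring V) \<noteq> ?P" by blast
  qed (use prime in auto)
qed

lemma primeideal_vimage_quot:
  assumes "cring R" "ideal I R" "primeideal P (R Quot I)"
  shows "primeideal {r \<in> carrier R. I +>\<^bsub>R\<^esub> r \<in> P} R" and "I \<subseteq> {r \<in> carrier R. I +>\<^bsub>R\<^esub> r \<in> P}"
proof -
  interpret I: ideal I R by fact
  interpret P: primeideal P "R Quot I" by fact
  interpret h: ring_hom_ring R "R Quot I" "(+>\<^bsub>R\<^esub>) I" by (rule I.rcos_ring_hom_ring)
  let ?Q = "{r \<in> carrier R. I +>\<^bsub>R\<^esub> r \<in> P}"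
  show "primeideal ?Q R"
  proof (rule primeidealI[OF h.ideal_vimage[OF P.is_ideal] assms(1)])
    show "carrier R \<noteq> ?Q"
    proof
      assume "carrier R = ?Q"
      then have "\<one>\<^bsub>R\<^esub> \<in> ?Q" using I.one_closed by blast
      then have "\<one>\<^bsub>R Quot I\<^esub> \<in> P" using h.hom_one by (simp only: mem_Collect_eq)
      then show False using P.one_imp_carrier P.I_notcarr by blast
    qed
    fix a b assume "a \<in> carrier R" "b \<in> carrier R" "a \<otimes>\<^bsub>R\<^esub> b \<in> ?Q"
    then show "a \<in> ?Q \<or> b \<in> ?Q" using P.I_prime[of "I +>\<^bsub>R\<^esub> a" "I +>\<^bsub>R\<^esub> b"] by auto
  qed
  show "I \<subseteq> ?Q"
  proof
    fix r assume "r \<in> I"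
    moreover have "I \<in> P" 
      using additive_subgroup.zero_closed[OF P.additive_subgroup_axioms] by (simp only: FactRing_zero)
    ultimately show "r \<in> ?Q" using I.a_rcos_const[of r] I.Icarr by simp
  qed
qed

text \<open>Passing to the quotient loses no information on ideals above \<open>I\<close>, so strict inclusions of
  primes stay strict there.\<close>
lemma mem_image_quot_iff:
  assumes "ring R" "ideal I R" "ideal Q R" "I \<subseteq> Q" "r \<in> carrier R"
  shows "I +>\<^bsub>R\<^esub> r \<in> (+>\<^bsub>R\<^esub>) I ` Q \<longleftrightarrow> r \<in> Q"
proof
  interpret R: ring R by fact
  interpret Q: ideal Q R by fact
  assume "I +>\<^bsub>R\<^esub> r \<in> (+>\<^bsub>R\<^esub>) I ` Q"
  then obtain s where s: "s \<in> Q" "I +>\<^bsub>R\<^esub> r = I +>\<^bsub>R\<^esub> s" by blast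
  then have "r \<ominus>\<^bsub>R\<^esub> s \<in> Q"
    using R.quotient_eq_iff_same_a_r_cos[OF assms(2) assms(5) Q.Icarr[OF s(1)]] assms(4) by blast
  then have "(r \<ominus>\<^bsub>R\<^esub> s) \<oplus>\<^bsub>R\<^esub> s \<in> Q" using s(1) Q.a_closed by blast
  moreover have "(r \<ominus>\<^bsub>R\<^esub> s) \<oplus>\<^bsub>R\<^esub> s = r"
    using assms(5) Q.Icarr[OF s(1)] by (simp add: a_minus_def R.a_assoc R.l_neg)
  ultimately show "r \<in> Q" by simp
qed auto

lemma primeideal_image_quot:
  assumes "cring R" "ideal I R" "primeideal Q R" "I \<subseteq> Q"
  shows "primeideal ((+>\<^bsub>R\<^esub>) I ` Q) (R Quot I)"
proof -
  interpret R: cring R by fact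
  interpret I: ideal I R by fact
  interpret Q: primeideal Q R by fact
  interpret h: ring_hom_ring R "R Quot I" "(+>\<^bsub>R\<^esub>) I" by (rule I.rcos_ring_hom_ring)
  note mem = mem_image_quot_iff[OF R.ring_axioms assms(2) Q.is_ideal assms(4)]
  have surj: "carrier (R Quot I) = (+>\<^bsub>R\<^esub>) I ` carrier R"
    unfolding FactRing_def A_RCOSETS_def' by auto
  show ?thesis
  proof (rule primeidealI[OF R.ring_ideal_imp_quot_ideal[OF assms(2) Q.is_ideal] I.quotient_is_cring[OF assms(1)]])
    have "\<one>\<^bsub>R\<^esub> \<notin> Q" using Q.one_imp_carrier Q.I_notcarr by blast
    then show "carrier (R Quot I) \<noteq> (+>\<^bsub>R\<^esub>) I ` Q" using mem[OF R.one_closed] surj R.one_closed by (metis image_eqI)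
    fix x y assume "x \<in> carrier (R Quot I)" "y \<in> carrier (R Quot I)"
      and xy: "x \<otimes>\<^bsub>R Quot I\<^esub> y \<in> (+>\<^bsub>R\<^esub>) I ` Q"
    obtain a where a: "x = I +>\<^bsub>R\<^esub> a" "a \<in> carrier R"
      using \<open>x \<in> carrier (R Quot I)\<close> unfolding surj by (rule imageE)
    obtain b where b: "y = I +>\<^bsub>R\<^esub> b" "b \<in> carrier R"
      using \<open>y \<in> carrier (R Quot I)\<close> unfolding surj by (rule imageE)
    note ab = a(2) b(2) a(1) b(1)
    have "I +>\<^bsub>R\<^esub> (a \<otimes>\<^bsub>R\<^esub> b) = x \<otimes>\<^bsub>R Quot I\<^esub> y"
      unfolding ab(3,4) by (rule h.hom_mult[OF ab(1,2)])
    with xy have "I +>\<^bsub>R\<^esub> (a \<otimes>\<^bsub>R\<^esub> b) \<in> (+>\<^bsub>R\<^esub>) I ` Q" by (simp only:)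
    then have "a \<otimes>\<^bsub>R\<^esub> b \<in> Q" using mem[OF R.m_closed[OF ab(1,2)]] by blast
    then show "x \<in> (+>\<^bsub>R\<^esub>) I ` Q \<or> y \<in> (+>\<^bsub>R\<^esub>) I ` Q" using Q.I_prime[OF ab(1,2)] ab by blast
  qed
qed

lemma
  fixes P :: "('v, 'k::field) mpoly set"
  assumes "primeideal P (poly_ring V)"
  shows primeideal_subset: "P \<subseteq> carrier (poly_ring V)"
    and primeideal_zero: "0 \<in> P"
    and primeideal_add: "\<And>p q. p \<in> P \<Longrightarrow> q \<in> P \<Longrightarrow> p + q \<in> P"
    and primeideal_diff: "\<And>p q. p \<in> P \<Longrightarrow> q \<in> P \<Longrightarrow> p - q \<in> P"
    and primeideal_mult: "\<And>p q. p \<in> carrier (poly_ring V) \<Longrightarrow> q \<in> P \<Longrightarrow> p * q \<in> P"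
    and primeideal_cases: "\<And>p q. p \<in> carrier (poly_ring V) \<Longrightarrow> q \<in> carrier (poly_ring V) \<Longrightarrow> p * q \<in> P \<Longrightarrow> p \<in> P \<or> q \<in> P"
    and primeideal_one: "1 \<notin> P"
proof -
  interpret P: primeideal P "poly_ring V" by fact
  show sub: "P \<subseteq> carrier (poly_ring V)" by (rule P.a_subset)
  show "0 \<in> P" using additive_subgroup.zero_closed[OF P.additive_subgroup_axioms] by simp
  show add: "p + q \<in> P" if "p \<in> P" "q \<in> P" for p q using additive_subgroup.a_closed[OF P.additive_subgroup_axioms that] by simp
  show mult: "p * q \<in> P" if "p \<in> carrier (poly_ring V)" "q \<in> P" for p q
    using P.I_l_closed[OF that(2,1)] by simp
  show "p - q \<in> P" if "p \<in> P" "q \<in> P" for p q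
  proof -
    have "- 1 * q \<in> P" using that by (intro mult) (auto simp: poly_ring_carrier keys_uminus)
    then show ?thesis using add[of p "- q"] that by simp
  qed
  show "p \<in> P \<or> q \<in> P" if "p \<in> carrier (poly_ring V)" "q \<in> carrier (poly_ring V)" "p * q \<in> P" for p q
    using P.I_prime[of p q] that by simp
  show "1 \<notin> P" using P.one_imp_carrier P.I_notcarr by auto
qed

lemma primeideal_sum:
  assumes "primeideal P (poly_ring V)" "\<And>a. a \<in> A \<Longrightarrow> f a \<in> P"
  shows "sum f A \<in> P"
  using assms(2) by (induction A rule: infinite_finite_induct) (auto simp: primeideal_zero[OF assms(1)] primeideal_add[OF assms(1)])

lemma poly_ring_mult_closed: "p \<in> carrier (poly_ring V) \<Longrightarrow> q \<in> carrier (poly_ring V) \<Longrightarrow> p * q \<in> carrier (poly_ring V :: ('v, 'k::field) mpoly ring)"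
  using monoid.m_closed[OF ring.is_monoid[OF cring.axioms(1)[OF poly_ring_cring]], of p V q] by simp

lemma poly_ring_add_closed: "p \<in> carrier (poly_ring V) \<Longrightarrow> q \<in> carrier (poly_ring V) \<Longrightarrow> p + q \<in> carrier (poly_ring V :: ('v, 'k::field) mpoly ring)"
  using abelian_monoid.a_closed[OF abelian_group.axioms(1)[OF ring.is_abelian_group[OF cring.axioms(1)[OF poly_ring_cring]]], of p V q] by simp

lemma poly_ring_const_closed: "pconst c \<in> carrier (poly_ring V)"
  by (auto simp: pconst_def poly_ring_carrier)

lemma poly_ring_one_closed: "1 \<in> carrier (poly_ring V)" by (auto simp: poly_ring_carrier)

lemma poly_ring_power_closed: "p \<in> carrier (poly_ring V) \<Longrightarrow> p ^ k \<in> carrier (poly_ring V :: ('v, 'k::field) mpoly ring)"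
  by (induction k) (auto simp: poly_ring_one_closed poly_ring_mult_closed)

lemma poly_ring_prod_closed: "(\<And>a. a \<in> A \<Longrightarrow> f a \<in> carrier (poly_ring V)) \<Longrightarrow> prod f A \<in> carrier (poly_ring V :: ('v, 'k::field) mpoly ring)"
  by (induction A rule: infinite_finite_induct) (auto simp: poly_ring_one_closed poly_ring_mult_closed)

lemma poly_ring_sum_closed: "(\<And>a. a \<in> A \<Longrightarrow> f a \<in> carrier (poly_ring V)) \<Longrightarrow> sum f A \<in> carrier (poly_ring V :: ('v, 'k::field) mpoly ring)"
  by (induction A rule: infinite_finite_induct) (auto simp: poly_ring_add_closed poly_ring_carrier[of 0])

lemma primeideal_power_cases:
  assumes P: "primeideal P (poly_ring V)" and "x \<in> carrier (poly_ring V)" "y \<in> carrier (poly_ring V)"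
    "x \<notin> P" "x ^ k * y \<in> P"
  shows "y \<in> P"
  using assms(5)
proof (induction k)
  case (Suc k)
  then have "x * (x ^ k * y) \<in> P" by (simp add: mult.assoc)
  then have "x ^ k * y \<in> P"
    using primeideal_cases[OF P assms(2), of "x ^ k * y"] poly_ring_mult_closed[OF poly_ring_power_closed[OF assms(2)] assms(3)] assms(4) by blast
  then show ?case by (rule Suc.IH)
qed simp

section \<open>The Krull dimension of a Stanley-Reisner ring\<close>

text \<open>Elements \<open>x\<^sub>i\<close> that witness the strictness of a chain of primes are algebraically independent modulo the
  smallest prime.  In a relation modulo \<open>P\<^sub>k\<close>, divide by the smallest power of \<open>x\<^sub>k\<close> that
  occurs, which is possible because \<open>x\<^sub>k \<notin> P\<^sub>k\<close>.  Modulo \<open>P\<^bsub>k+1\<^esub>\<close>, which contains \<open>x\<^sub>k\<close>, the terms that were divided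
  exactly survive, and they form a relation among \<open>x\<^bsub>k+1\<^esub>, x\<^bsub>k+2\<^esub>, \<dots>\<close>, which is trivial by induction.  A
  constant in the last, proper prime vanishes.\<close>
lemma prime_chain_algebraically_independent:
  fixes x :: "nat \<Rightarrow> ('v, 'k::field) mpoly" and c :: "(nat \<Rightarrow> nat) \<Rightarrow> 'k"
  assumes P: "\<And>i. i \<le> l \<Longrightarrow> primeideal (P i) (poly_ring V)"
    and sub: "\<And>i. i < l \<Longrightarrow> P i \<subseteq> P (Suc i)"
    and x: "\<And>i. i < l \<Longrightarrow> x i \<in> P (Suc i) - P i"
    and "k \<le> l" "finite A" "\<And>a. a \<in> A \<Longrightarrow> c a \<noteq> 0"
    and "\<And>a b. a \<in> A \<Longrightarrow> b \<in> A \<Longrightarrow> (\<And>i. k \<le> i \<Longrightarrow> i < l \<Longrightarrow> a i = b i) \<Longrightarrow> a = b"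
    and "(\<Sum>a\<in>A. pconst (c a) * (\<Prod>i=k..<l. x i ^ a i)) \<in> P k"
  shows "A = {}"
  using assms(4-)
proof (induction k arbitrary: A rule: inc_induct)
  case base
  show ?case
  proof (rule ccontr)
    assume "A \<noteq> {}"
    then obtain a where a: "a \<in> A" by blast
    then have A: "A = {a}" using base(3) by force
    have "pconst (c a) \<in> P l" using base(4) by (simp add: A)
    then have "pconst (inverse (c a)) * pconst (c a) \<in> P l"
      by (intro primeideal_mult[OF P] poly_ring_const_closed) auto
    moreover have "pconst (inverse (c a)) * pconst (c a) = (1 :: ('v, 'k) mpoly)"
      using base(2)[OF a] by (simp add: pconst_def mult_single)
    ultimately show False using primeideal_one[OF P[of l]] by simp
  qed
next
  case (step k)
  have Pk: "primeideal (P k) (poly_ring V)" and PSk: "primeideal (P (Suc k)) (poly_ring V)"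
    using P step.hyps by auto
  have xc: "x i \<in> carrier (poly_ring V)" if "i < l" for i
    using x[OF that] primeideal_subset[OF P[of "Suc i"]] that by auto
  define r where "r a = pconst (c a) * (\<Prod>i=Suc k..<l. x i ^ a i)" for a
  have rc: "r a \<in> carrier (poly_ring V)" for a
    unfolding r_def using xc by (intro poly_ring_mult_closed poly_ring_const_closed poly_ring_prod_closed poly_ring_power_closed) auto
  have r: "pconst (c a) * (\<Prod>i=k..<l. x i ^ a i) = x k ^ a k * r a" for a
    using step.hyps by (simp add: r_def prod.atLeast_Suc_lessThan mult_ac)
  show ?case
  proof (rule ccontr)
    assume "A \<noteq> {}"
    define \<mu> where "\<mu> = Min ((\<lambda>a. a k) ` A)"
    have \<mu>: "\<mu> \<le> a k" if "a \<in> A" for a using that step.prems(1) by (simp add: \<mu>_def)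
    have "\<mu> \<in> (\<lambda>a. a k) ` A" unfolding \<mu>_def using step.prems(1) \<open>A \<noteq> {}\<close> by (intro Min_in) auto
    then obtain a0 where a0: "a0 \<in> A" "a0 k = \<mu>" by auto
    define A0 where "A0 = {a \<in> A. a k = \<mu>}"
    define s where "s = (\<Sum>a\<in>A. x k ^ (a k - \<mu>) * r a)"
    have sc: "s \<in> carrier (poly_ring V)"
      unfolding s_def using xc[of k] step.hyps rc by (intro poly_ring_sum_closed poly_ring_mult_closed poly_ring_power_closed) auto
    have "(\<Sum>a\<in>A. pconst (c a) * (\<Prod>i=k..<l. x i ^ a i)) = x k ^ \<mu> * s"
      unfolding s_def r sum_distrib_left
      by (intro sum.cong refl) (simp add: \<mu> flip: power_add mult.assoc)
    then have "s \<in> P k"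
      using primeideal_power_cases[OF Pk xc[of k] sc] step.prems(4) x[of k] step.hyps by auto
    then have "s \<in> P (Suc k)" using sub step.hyps by blast
    moreover have "s = (\<Sum>a\<in>A0. r a) + (\<Sum>a\<in>A - A0. x k ^ (a k - \<mu>) * r a)"
    proof -
      have "(\<Sum>a\<in>A0. x k ^ (a k - \<mu>) * r a) = (\<Sum>a\<in>A0. r a)"
        by (intro sum.cong) (auto simp: A0_def)
      moreover have "A0 \<subseteq> A" by (auto simp: A0_def)
      moreover from this have "s = (\<Sum>a\<in>A - A0. x k ^ (a k - \<mu>) * r a) + (\<Sum>a\<in>A0. x k ^ (a k - \<mu>) * r a)"
        unfolding s_def by (rule sum.subset_diff[OF _ step.prems(1)])
      ultimately show ?thesis by (simp only: add.commute)
    qed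
    moreover have "(\<Sum>a\<in>A - A0. x k ^ (a k - \<mu>) * r a) \<in> P (Suc k)"
    proof (rule primeideal_sum[OF PSk])
      fix a assume a: "a \<in> A - A0"
      then have "\<mu> < a k" using \<mu>[of a] by (auto simp: A0_def)
      then obtain j where "a k - \<mu> = Suc j" by (metis Suc_diff_Suc)
      then have "x k ^ (a k - \<mu>) * r a = (x k ^ j * r a) * x k" by (simp add: mult_ac)
      moreover have "(x k ^ j * r a) * x k \<in> P (Suc k)"
        using x[of k] xc[of k] step.hyps rc by (intro primeideal_mult[OF PSk] poly_ring_mult_closed poly_ring_power_closed) auto
      ultimately show "x k ^ (a k - \<mu>) * r a \<in> P (Suc k)" by simp
    qed
    ultimately have "(\<Sum>a\<in>A0. r a) + t - t \<in> P (Suc k)"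
      if "t = (\<Sum>a\<in>A - A0. x k ^ (a k - \<mu>) * r a)" for t
      unfolding that by (intro primeideal_diff[OF PSk]) (simp_all only:)
    then have "(\<Sum>a\<in>A0. r a) \<in> P (Suc k)" by (simp only: add_diff_cancel_right' refl)
    have "A0 = {}"
    proof (rule step.IH)
      show "(\<Sum>a\<in>A0. pconst (c a) * (\<Prod>i=Suc k..<l. x i ^ a i)) \<in> P (Suc k)"
        using \<open>(\<Sum>a\<in>A0. r a) \<in> P (Suc k)\<close> by (simp add: r_def)
      fix a b assume ab: "a \<in> A0" "b \<in> A0" "\<And>i. Suc k \<le> i \<Longrightarrow> i < l \<Longrightarrow> a i = b i"
      show "a = b"
      proof (rule step.prems(3))
        fix i assume "k \<le> i" "i < l"
        then show "a i = b i" using ab by (cases "i = k") (auto simp: A0_def)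
      qed (use ab in \<open>auto simp: A0_def\<close>)
    qed (use step.prems in \<open>auto simp: A0_def\<close>)
    then show False using a0 by (auto simp: A0_def)
  qed
qed

text \<open>A bound on the exponent of each single variable is compatible with the count of the monomials in a
  box, and it adds up under products like a degree.\<close>
definition exponents_le :: "nat \<Rightarrow> ('v, 'k::field) mpoly \<Rightarrow> bool" where
  "exponents_le e p \<longleftrightarrow> (\<forall>m\<in>Poly_Mapping.keys p. \<forall>v. Poly_Mapping.lookup m v \<le> e)"

lemma exponents_le_mult: "exponents_le d p \<Longrightarrow> exponents_le e q \<Longrightarrow> exponents_le (d + e) (p * q)"
  by (auto simp: exponents_le_def lookup_add add_mono elim!: keys_mult_elim)

lemma exponents_le_mono: "exponents_le d p \<Longrightarrow> d \<le> e \<Longrightarrow> exponents_le e p"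
  by (auto simp: exponents_le_def intro: order_trans)

lemma exponents_le_power: "exponents_le e p \<Longrightarrow> exponents_le (k * e) (p ^ k)"
  by (induction k) (auto simp: exponents_le_mult, simp add: exponents_le_def)

lemma exponents_le_prod:
  "(\<And>i. i \<in> A \<Longrightarrow> exponents_le e (f i)) \<Longrightarrow> exponents_le (card A * e) (prod f A)"
  by (induction A rule: infinite_finite_induct) (auto simp: exponents_le_mult, auto simp: exponents_le_def)

lemma exponents_le_exists: "\<exists>e. exponents_le e p"
proof -
  have "Poly_Mapping.lookup m v \<le> (\<Sum>m\<in>Poly_Mapping.keys p. mdeg m)" if "m \<in> Poly_Mapping.keys p" for m v
    using lookup_le_mdeg[of m v] member_le_sum[OF that, of mdeg] by force
  then show ?thesis unfolding exponents_le_def by blast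
qed

context simplicial_complex
begin

text \<open>The witnesses \<open>x\<^sub>0, \<dots>, x\<^bsub>l-1\<^esub>\<close> of the strictness of the chain are algebraically independent modulo \<open>I\<^sub>\<Delta>\<close>.
  So the \<open>(s+1)\<^sup>l\<close> power products with exponents at most \<open>s\<close> are linearly independent modulo \<open>I\<^sub>\<Delta>\<close>, while their
  classes lie in the span of the monomials on faces with exponents \<open>O(s)\<close>, of which there are only
  \<open>O(s\<^sup>d)\<close>.  For large \<open>s\<close> this forces \<open>l \<le> d\<close>.\<close>
lemma prime_chain_length:
  assumes P: "\<And>i. i \<le> l \<Longrightarrow> primeideal (P i :: ('v, 'k::field) mpoly set) (poly_ring V)"
    and chain: "\<And>i. i < l \<Longrightarrow> P i \<subset> P (Suc i)"
    and I: "nonface_ideal V \<Delta> \<subseteq> P 0"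
    and d: "\<And>F. F \<in> \<Delta> \<Longrightarrow> card F \<le> d"
  shows "l \<le> d"
proof (rule ccontr)
  assume "\<not> l \<le> d"
  have "\<exists>y. y \<in> P (Suc i) - P i" if "i < l" for i using chain[OF that] by blast
  then obtain x where x: "\<And>i. i < l \<Longrightarrow> x i \<in> P (Suc i) - P i" by metis
  define e where "e = (\<Sum>i<l. SOME e. exponents_le e (x i))"
  have e: "exponents_le e (x i)" if "i < l" for i
    using exponents_le_mono[OF someI_ex[OF exponents_le_exists[of "x i"]]]
      member_le_sum[of i "{..<l}" "\<lambda>i. SOME e. exponents_le e (x i)"] that unfolding e_def by simp
  have bound: "(s + 1) ^ l \<le> card \<Delta> * (l * (s * e) + 1) ^ d" for s
  proof (rule ccontr)
    assume large: "\<not> ?thesis"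
    define B where "B = PiE {..<l} (\<lambda>_. {..s})"
    define T where "T = (\<Union>F\<in>\<Delta>. {m :: 'v \<Rightarrow>\<^sub>0 nat. Poly_Mapping.keys m \<subseteq> F \<and> (\<forall>v. Poly_Mapping.lookup m v \<le> l * (s * e))})"
    define f where "f a = (\<Prod>i=0..<l. x i ^ a i)" for a
    have "card T \<le> (\<Sum>F\<in>\<Delta>. (l * (s * e) + 1) ^ card F)"
      unfolding T_def using finite_bounded_monomials[OF finite_face]
      by (intro order_trans[OF card_UN_le[OF finite_faces]] sum_mono) blast
    also have "\<dots> \<le> (\<Sum>F\<in>\<Delta>. (l * (s * e) + 1) ^ d)"
      using d by (intro sum_mono power_increasing) auto
    finally have "card T < card B"
      using large by (simp add: B_def card_PiE)
    moreover have "finite T" unfolding T_def using finite_faces finite_bounded_monomials[OF finite_face] by blast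
    moreover have "finite B" unfolding B_def by (intro finite_PiE) auto
    ultimately obtain c where c: "\<exists>a\<in>B. c a \<noteq> 0"
      "\<forall>m\<in>T. (\<Sum>a\<in>B. c a * Poly_Mapping.lookup (f a) m) = 0"
      using nontrivial_solution[of T B "\<lambda>m a. Poly_Mapping.lookup (f a) m"] by blast
    \<comment> \<open>The nonzero coefficients of the linear relation give a combination of power products of the
      \<open>x i\<close> with no monomial on a face left.\<close>
    let ?A = "{a \<in> B. c a \<noteq> 0}"
    let ?p = "\<Sum>a\<in>?A. pconst (c a) * f a"
    have coeff: "Poly_Mapping.lookup ?p m = (\<Sum>a\<in>B. c a * Poly_Mapping.lookup (f a) m)" for m
    proof -
      have "Poly_Mapping.lookup (pconst k * g) m = k * Poly_Mapping.lookup g m" for k and g :: "('v, 'k) mpoly"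
        unfolding lookup_mult_keys pconst_def
        by (auto simp: when_def in_keys_iff)
      then show ?thesis
        using \<open>finite B\<close> by (simp add: lookup_sum) (intro sum.mono_neutral_left, auto)
    qed
    have fc: "f a \<in> carrier (poly_ring V)" for a
      unfolding f_def
    proof (intro poly_ring_prod_closed poly_ring_power_closed)
      fix i assume "i \<in> {0..<l}"
      then show "x i \<in> carrier (poly_ring V)"
        using x[of i] primeideal_subset[OF P[of "Suc i"]] by auto
    qed
    have fe: "exponents_le (l * (s * e)) (f a)" if "a \<in> B" for a
    proof -
      have "exponents_le (s * e) (x i ^ a i)" if "i < l" for i
        using \<open>a \<in> B\<close> that by (intro exponents_le_mono[OF exponents_le_power[OF e[OF that]]]) (auto simp: B_def PiE_iff)
      then show ?thesis unfolding f_def using exponents_le_prod[of "{0..<l}" "s * e" "\<lambda>i. x i ^ a i"] by simp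
    qed
    have "?p \<in> nonface_ideal V \<Delta>"
      unfolding nonface_ideal_def
    proof (intro CollectI ballI conjI)
      fix m assume m: "m \<in> Poly_Mapping.keys ?p"
      have "?p \<in> carrier (poly_ring V)" using fc by (intro poly_ring_sum_closed poly_ring_mult_closed poly_ring_const_closed)
      then show "Poly_Mapping.keys m \<subseteq> V" using m unfolding poly_ring_carrier by blast
      have nz: "(\<Sum>a\<in>B. c a * Poly_Mapping.lookup (f a) m) \<noteq> 0" using m coeff[of m] by (simp add: in_keys_iff)
      obtain a where a: "a \<in> B" "c a * Poly_Mapping.lookup (f a) m \<noteq> 0"
        by (rule sum.not_neutral_contains_not_neutral[OF nz])
      then have "\<forall>v. Poly_Mapping.lookup m v \<le> l * (s * e)"
        using fe by (auto simp: exponents_le_def in_keys_iff)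
      then show "Poly_Mapping.keys m \<notin> \<Delta>" using c(2) nz by (auto simp: T_def)
    qed
    then have "?p \<in> P 0" using I by blast
    then have "(\<Sum>a\<in>?A. pconst (c a) * (\<Prod>i=0..<l. x i ^ a i)) \<in> P 0" by (simp only: f_def)
    have "?A = {}"
    proof (rule prime_chain_algebraically_independent[where P = P and x = x and l = l and k = 0 and c = c])
      show "(\<Sum>a\<in>?A. pconst (c a) * (\<Prod>i=0..<l. x i ^ a i)) \<in> P 0" by fact
      fix a b assume "a \<in> ?A" "b \<in> ?A" "\<And>i. 0 \<le> i \<Longrightarrow> i < l \<Longrightarrow> a i = b i"
      then show "a = b" by (intro PiE_ext[of a "{..<l}" "\<lambda>_. {..s}" b]) (auto simp: B_def)
    next
      fix i assume "i < l"
      then show "P i \<subseteq> P (Suc i)" using chain by blast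
    qed (use P x \<open>finite B\<close> in auto)
    then show False using c(1) by blast
  qed
  \<comment> \<open>The bound is at most \<open>?C * (s + 1) ^ d\<close>, so it fails at \<open>s = ?C\<close>.\<close>
  let ?C = "card \<Delta> * (l * e + 1) ^ d"
  have "(?C + 1) ^ l \<le> card \<Delta> * (l * (?C * e) + 1) ^ d" by (rule bound)
  also have "\<dots> \<le> card \<Delta> * ((l * e + 1) * (?C + 1)) ^ d"
    by (intro mult_left_mono power_mono) (auto simp: algebra_simps)
  also have "\<dots> = ?C * (?C + 1) ^ d" by (simp only: power_mult_distrib mult.assoc)
  also have "\<dots> < (?C + 1) ^ Suc d" by simp
  also have "\<dots> \<le> (?C + 1) ^ l" using \<open>\<not> l \<le> d\<close> by (intro power_increasing) auto
  finally show False by simp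
qed

text \<open>For a face of largest size, dropping its vertices one at a time gives a descending chain of simplices,
  and their ideals form a chain of primes that attains the bound.\<close>
lemma krull_dim_quot:
  assumes F: "F \<in> \<Delta>" "card F = d" and d: "\<And>F. F \<in> \<Delta> \<Longrightarrow> card F \<le> d"
  shows "krull_dim (poly_ring V Quot (nonface_ideal V \<Delta> :: ('v, 'k::field) mpoly set)) = enat d"
proof -
  let ?R = "poly_ring V :: ('v, 'k) mpoly ring" and ?I = "nonface_ideal V \<Delta> :: ('v, 'k) mpoly set"
  let ?\<pi> = "(+>\<^bsub>?R\<^esub>) ?I"
  let ?Q = "?R Quot ?I"
  have upper: "l \<le> d"
    if P: "\<forall>i\<le>l. primeideal (P i) ?Q" and chain: "\<forall>i<l. P i \<subset> P (Suc i)" for l P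
  proof -
    define P' where "P' i = {r \<in> carrier ?R. ?\<pi> r \<in> P i}" for i
    have prime: "primeideal (P' i) ?R" if "i \<le> l" for i
      unfolding P'_def using P that by (intro primeideal_vimage_quot poly_ring_cring nonface_ideal) auto
    have I: "?I \<subseteq> P' 0"
      unfolding P'_def using P by (intro primeideal_vimage_quot poly_ring_cring nonface_ideal) auto
    have "P' i \<subset> P' (Suc i)" if "i < l" for i
    proof -
      have sub: "P i \<subset> P (Suc i)" using chain that by blast
      then obtain X where X: "X \<in> P (Suc i)" "X \<notin> P i" by blast
      interpret PS: primeideal "P (Suc i)" ?Q using P that by (simp add: Suc_leI)
      have "X \<in> carrier ?Q" using X PS.Icarr by blast
      then obtain r where "r \<in> carrier ?R" "X = ?\<pi> r"
        unfolding FactRing_def A_RCOSETS_def' by auto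
      then show ?thesis using X sub unfolding P'_def by blast
    qed
    from prime_chain_length[OF prime this I d] show ?thesis by simp
  qed
  have lower: "\<exists>P. (\<forall>i\<le>d. primeideal (P i) ?Q) \<and> (\<forall>i<d. P i \<subset> P (Suc i))"
  proof -
    obtain f where f: "bij_betw f {..<d} F"
      using ex_bij_betw_nat_finite[OF finite_face[OF F(1)]] F(2) by (auto simp: atLeast0LessThan)
    define P where "P i = (nonface_ideal V (Pow (f ` {i..<d})) :: ('v, 'k) mpoly set)" for i
    have fF: "f ` {i..<d} \<subseteq> F" for i using f by (auto simp: bij_betw_def)
    have FV: "F \<subseteq> V" using face_subset F by blast
    have prime: "primeideal (P i) ?R" for i
      unfolding P_def using fF FV by (intro nonface_ideal_simplex_prime[OF finite_vertices]) blast
    have I: "?I \<subseteq> P i" for i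
      using face_mono[OF F(1)] fF[of i] by (fastforce simp: P_def nonface_ideal_def)
    have id: "ideal (P i) ?R" for i using prime by (rule primeideal.axioms)
    note mem = mem_image_quot_iff[OF cring.axioms(1)[OF poly_ring_cring] nonface_ideal id I]
    have "?\<pi> ` P i \<subset> ?\<pi> ` P (Suc i)" if "i < d" for i
    proof -
      have fi: "f i \<in> f ` {i..<d}" "f i \<notin> f ` {Suc i..<d}" "f i \<in> V"
        using f that FV inj_on_image_mem_iff[of f "{..<d}" i "{Suc i..<d}"]
        by (auto simp: bij_betw_def subset_iff)
      have "pvar (f i) \<in> P (Suc i)" "pvar (f i) \<notin> P i" "pvar (f i) \<in> carrier ?R"
        using fi by (auto simp: P_def nonface_ideal_def pvar_def poly_ring_carrier)
      then have "?\<pi> (pvar (f i)) \<in> ?\<pi> ` P (Suc i)" "?\<pi> (pvar (f i)) \<notin> ?\<pi> ` P i"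
        using mem by blast+
      moreover have "f ` {Suc i..<d} \<subseteq> f ` {i..<d}" by auto
      then have "P i \<subseteq> P (Suc i)" unfolding P_def nonface_ideal_def by blast
      ultimately show ?thesis by blast
    qed
    moreover have "primeideal (?\<pi> ` P i) ?Q" for i
      by (rule primeideal_image_quot[OF poly_ring_cring nonface_ideal prime I])
    ultimately show ?thesis by (intro exI[of _ "\<lambda>i. ?\<pi> ` P i"]) auto
  qed
  show ?thesis
    unfolding krull_dim_def
  proof (rule antisym)
    show "Sup {enat l | l. \<exists>P. (\<forall>i\<le>l. primeideal (P i) ?Q) \<and> (\<forall>i<l. P i \<subset> P (Suc i))} \<le> enat d"
      using upper by (intro Sup_least) auto
    show "enat d \<le> Sup {enat l | l. \<exists>P. (\<forall>i\<le>l. primeideal (P i) ?Q) \<and> (\<forall>i<l. P i \<subset> P (Suc i))}"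
      using lower by (intro Sup_upper) blast
  qed
qed

text \<open>The dimension \<open>d\<close> clears every denominator \<open>(1 - t)\<^bsup>card F\<^esup>\<close> of the Hilbert series, so the polynomial
  that the definition asks for exists; power series determine it uniquely.\<close>
lemma h_quot_nonface_ideal:
  assumes F: "F \<in> \<Delta>" "card F = d" and d: "\<And>F. F \<in> \<Delta> \<Longrightarrow> card F \<le> d"
  shows "h_quot V (nonface_ideal V \<Delta> :: ('v, 'k::field) mpoly set)
    = (\<Sum>F\<in>\<Delta>. [:0, 1:] ^ card F * [:1, -1:] ^ (d - card F))" (is "_ = ?h")
proof -
  let ?R = "poly_ring V :: ('v, 'k) mpoly ring" and ?I = "nonface_ideal V \<Delta> :: ('v, 'k) mpoly set"
  let ?\<pi> = "(+>\<^bsub>?R\<^esub>) ?I"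
  let ?H = "hilbert_series (?R Quot ?I) (?\<pi> ` range pconst) (\<lambda>d. ?\<pi> ` {f \<in> carrier ?R. homogeneous d f})"
  have "?H = Abs_fps (\<lambda>k. int (card (standard_monomials k)))"
    unfolding hilbert_series_def hilbert_function ..
  then have "?H * (1 - fps_X) ^ d = (\<Sum>F\<in>\<Delta>. fps_X ^ card F * (1 - fps_X) ^ (d - card F))"
    using standard_monomials_series[OF d] by simp
  also have "\<dots> = fps_of_poly ?h"
  proof -
    have "fps_of_poly [:0, 1 :: int:] = fps_X" "fps_of_poly [:1, -1 :: int:] = 1 - fps_X"
      by (rule fps_ext; auto simp: fps_X_def coeff_pCons split: nat.splits)+
    then show ?thesis by (simp only: fps_of_poly_sum fps_of_poly_mult fps_of_poly_power)
  qed
  finally have H: "?H * (1 - fps_X) ^ d = fps_of_poly ?h" .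
  have kd: "krull_dim (?R Quot ?I) = enat d" by (rule krull_dim_quot[OF assms])
  have "h_quot V ?I = (THE h. ?H * (1 - fps_X) ^ d = fps_of_poly h)"
    unfolding h_quot_def h_polynomial_def Let_def kd the_enat.simps ..
  also have "\<dots> = ?h" using H by (intro the_equality) (simp_all add: fps_of_poly_eq_iff)
  finally show ?thesis .
qed

end

section \<open>Edge and cover ideals as Stanley-Reisner ideals\<close>

lemma independent_set_iff:
  assumes "finite_simple_graph H"
  shows "independent_set H F \<longleftrightarrow> F \<subseteq> verts H \<and> (\<forall>e\<in>edges H. \<not> e \<subseteq> F)"
proof
  assume F: "independent_set H F"
  have False if e: "e \<in> edges H" "e \<subseteq> F" for e
  proof -
    have "card e = 2" using assms e by (simp add: finite_simple_graph_def)
    then obtain u v where "e = {u, v}" by (auto simp: card_2_iff)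
    then show False using F e by (auto simp: independent_set_def)
  qed
  then show "F \<subseteq> verts H \<and> (\<forall>e\<in>edges H. \<not> e \<subseteq> F)" using F by (auto simp: independent_set_def)
qed (auto simp: independent_set_def)

text \<open>A set of vertices contains no edge if and only if it is independent, so the edge ideal is the
  Stanley-Reisner ideal of the independence complex.\<close>
lemma edge_ideal_eq:
  assumes H: "finite_simple_graph H"
  shows "simplicial_complex (verts H) {F. independent_set H F}"
    and "edge_ideal H = (nonface_ideal (verts H) {F. independent_set H F} :: ('v, 'k::field) mpoly set)"
proof -
  have gens: "{pvar u * pvar v | u v. {u, v} \<in> edges H} = ({\<Prod>v\<in>C. pvar v | C. C \<in> edges H} :: ('v, 'k) mpoly set)"
  proof (intro equalityI subsetI)
    fix p :: "('v, 'k) mpoly"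
    assume "p \<in> {pvar u * pvar v | u v. {u, v} \<in> edges H}"
    then obtain u v where uv: "{u, v} \<in> edges H" "p = pvar u * pvar v" by blast
    then have "card {u, v} = 2" using H by (simp add: finite_simple_graph_def)
    then have "u \<noteq> v" by auto
    then have "p = (\<Prod>v\<in>{u, v}. pvar v)" using uv by simp
    then show "p \<in> {\<Prod>v\<in>C. pvar v | C. C \<in> edges H}" using uv(1) by blast
  next
    fix p :: "('v, 'k) mpoly"
    assume "p \<in> {\<Prod>v\<in>C. pvar v | C. C \<in> edges H}"
    then obtain C where C: "C \<in> edges H" "p = (\<Prod>v\<in>C. pvar v)" by blast
    then have "card C = 2" using H by (simp add: finite_simple_graph_def)
    then obtain u v where uv: "C = {u, v}" "u \<noteq> v" by (auto simp: card_2_iff)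
    then have "p = pvar u * pvar v" using C by simp
    then show "p \<in> {pvar u * pvar v | u v. {u, v} \<in> edges H}" using C(1) uv(1) by blast
  qed
  have \<Delta>: "{F. independent_set H F} = {F. F \<subseteq> verts H \<and> (\<forall>C\<in>edges H. \<not> C \<subseteq> F)}"
    using independent_set_iff[OF H] by blast
  have "finite (verts H)" "\<And>C. C \<in> edges H \<Longrightarrow> C \<subseteq> verts H" "{} \<notin> edges H"
    using H by (auto simp: finite_simple_graph_def)
  note sf = genideal_squarefree[OF this]
  show "simplicial_complex (verts H) {F. independent_set H F}" unfolding \<Delta> by (rule sf(1))
  show "edge_ideal H = (nonface_ideal (verts H) {F. independent_set H F} :: ('v, 'k) mpoly set)"
    unfolding edge_ideal_def gens \<Delta> by (rule sf(2))
qed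

text \<open>A set of vertices is a vertex cover if and only if its complement is independent, and every vertex
  cover contains one of smallest size, which is minimal.\<close>
lemma contains_minimal_vertex_cover:
  assumes "finite_simple_graph H" "F \<subseteq> verts H"
  shows "(\<exists>C. minimal_vertex_cover H C \<and> C \<subseteq> F) \<longleftrightarrow> independent_set H (verts H - F)"
proof -
  have cover: "vertex_cover H F \<longleftrightarrow> independent_set H (verts H - F)"
  proof -
    have "e \<inter> F \<noteq> {} \<longleftrightarrow> \<not> e \<subseteq> verts H - F" if "e \<in> edges H" for e
      using that assms(1) unfolding finite_simple_graph_def by blast
    then show ?thesis
      using assms(2) unfolding vertex_cover_def independent_set_iff[OF assms(1)] by auto
  qed
  have "vertex_cover H F" if "minimal_vertex_cover H C" "C \<subseteq> F" for C
    using that assms(2) unfolding minimal_vertex_cover_def vertex_cover_def by blast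
  moreover have "\<exists>C. minimal_vertex_cover H C \<and> C \<subseteq> F" if F: "vertex_cover H F"
  proof -
    obtain C where C: "vertex_cover H C \<and> C \<subseteq> F" "\<And>D. vertex_cover H D \<and> D \<subseteq> F \<Longrightarrow> card C \<le> card D"
      using ex_has_least_nat[of "\<lambda>C. vertex_cover H C \<and> C \<subseteq> F" F card] F by auto
    have "finite C" using C(1) assms by (meson finite_simple_graph_def finite_subset)
    then have "minimal_vertex_cover H C"
      using C psubset_card_mono[of C] unfolding minimal_vertex_cover_def
      by (metis dual_order.trans leD psubset_imp_subset)
    then show ?thesis using C(1) by blast
  qed
  ultimately show ?thesis using cover by blast
qed

text \<open>A set of vertices contains no cover if and only if its complement is dependent, so the cover
  ideal belongs to the Alexander dual of the independence complex.\<close>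
lemma cover_ideal_eq:
  assumes H: "finite_simple_graph H" and "edges H \<noteq> {}"
  defines "\<Delta> \<equiv> {F. F \<subseteq> verts H \<and> \<not> independent_set H (verts H - F)}"
  shows "simplicial_complex (verts H) \<Delta>"
    and "cover_ideal H = (nonface_ideal (verts H) \<Delta> :: ('v, 'k::field) mpoly set)"
proof -
  have \<Delta>: "\<Delta> = {F. F \<subseteq> verts H \<and> (\<forall>C\<in>{C. minimal_vertex_cover H C}. \<not> C \<subseteq> F)}"
    unfolding \<Delta>_def using contains_minimal_vertex_cover[OF H] by blast
  have "finite (verts H)" "\<And>C. C \<in> {C. minimal_vertex_cover H C} \<Longrightarrow> C \<subseteq> verts H"
    "{} \<notin> {C. minimal_vertex_cover H C}"
    using H assms(2) by (auto simp: finite_simple_graph_def minimal_vertex_cover_def vertex_cover_def)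
  note sf = genideal_squarefree[OF this]
  show "simplicial_complex (verts H) \<Delta>" unfolding \<Delta> by (rule sf(1))
  have "cover_ideal H = genideal (poly_ring (verts H))
      ({\<Prod>v\<in>C. pvar v | C. C \<in> {C. minimal_vertex_cover H C}} :: ('v, 'k) mpoly set)"
    unfolding cover_ideal_def by simp
  also have "\<dots> = nonface_ideal (verts H) \<Delta>" unfolding \<Delta> by (rule sf(2))
  finally show "cover_ideal H = (nonface_ideal (verts H) \<Delta> :: ('v, 'k) mpoly set)" .
qed

section \<open>Graphs with whiskers\<close>

lemma verts_attach_whiskers: "verts (attach_whiskers q G) = verts G <+> (verts G \<times> {..<q})"
  by (auto simp: attach_whiskers_def)

lemma edges_attach_whiskers:
  "edges (attach_whiskers q G) = (\<lambda>e. Inl ` e) ` edges G \<union> {{Inl v, Inr (v, i)} | v i. v \<in> verts G \<and> i < q}"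
  by (simp add: attach_whiskers_def)

lemma finite_simple_attach_whiskers:
  assumes "finite_simple_graph G"
  shows "finite_simple_graph (attach_whiskers q G)"
proof -
  have "card (Inl ` e :: ('a + 'a \<times> nat) set) = card e" for e :: "'a set" by (intro card_image) simp
  then show ?thesis
    using assms unfolding finite_simple_graph_def verts_attach_whiskers edges_attach_whiskers by auto
qed

text \<open>The only neighbour of a whisker vertex is the vertex that it is attached to, so once \<open>S\<close> is
  chosen in \<open>G\<close> the whisker vertices outside \<open>S \<times> {..<q}\<close> are free.\<close>
lemma independent_sets_attach_whiskers:
  assumes G: "finite_simple_graph G"
  shows "{F. independent_set (attach_whiskers q G) F}
    = (\<lambda>(S, T). S <+> T) ` (SIGMA S:{S. independent_set G S}. Pow ((verts G - S) \<times> {..<q}))"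
    (is "?L = ?R")
proof (intro equalityI subsetI)
  let ?H = "attach_whiskers q G"
  note iff = independent_set_iff[OF finite_simple_attach_whiskers[OF G], of q]
  fix F assume "F \<in> ?L"
  then have F: "F \<subseteq> verts ?H" "\<And>e. e \<in> edges ?H \<Longrightarrow> \<not> e \<subseteq> F" unfolding mem_Collect_eq iff by blast+
  let ?S = "Inl -` F" and ?T = "Inr -` F"
  have "F = ?S <+> ?T" by (auto simp: Plus_def) (metis sum.exhaust rangeI image_vimage_eq IntI)
  moreover have "independent_set G ?S"
    unfolding independent_set_iff[OF G]
  proof (intro conjI ballI notI)
    show "?S \<subseteq> verts G" using F(1) by (auto simp: verts_attach_whiskers)
    fix e assume "e \<in> edges G" "e \<subseteq> ?S"
    then show False using F(2)[of "Inl ` e"] by (auto simp: edges_attach_whiskers)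
  qed
  moreover have "?T \<subseteq> (verts G - ?S) \<times> {..<q}"
  proof
    fix x assume x: "x \<in> ?T"
    then obtain v i where vi: "x = (v, i)" "v \<in> verts G" "i < q"
      using F(1) by (cases x) (auto simp: verts_attach_whiskers)
    then have "{Inl v, Inr (v, i)} \<in> edges ?H" by (auto simp: edges_attach_whiskers)
    then show "x \<in> (verts G - ?S) \<times> {..<q}" using F(2) vi x by force
  qed
  ultimately show "F \<in> ?R" by (intro image_eqI[of _ _ "(?S, ?T)"]) auto
next
  let ?H = "attach_whiskers q G"
  note iff = independent_set_iff[OF finite_simple_attach_whiskers[OF G], of q]
  fix F assume "F \<in> ?R"
  then obtain S T where ST: "F = S <+> T" "independent_set G S" "T \<subseteq> (verts G - S) \<times> {..<q}" by auto
  then have S: "S \<subseteq> verts G" "\<And>e. e \<in> edges G \<Longrightarrow> \<not> e \<subseteq> S" using independent_set_iff[OF G] by blast+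
  have "independent_set ?H F"
    unfolding iff edges_attach_whiskers verts_attach_whiskers
  proof (intro conjI ballI notI)
    show "F \<subseteq> verts G <+> verts G \<times> {..<q}" using ST S by auto
    fix e assume e: "e \<in> (\<lambda>e. Inl ` e) ` edges G \<union> {{Inl v, Inr (v, i)} | v i. v \<in> verts G \<and> i < q}" "e \<subseteq> F"
    from e(1) show False
    proof
      assume "e \<in> (\<lambda>e. Inl ` e) ` edges G"
      then obtain e' where e': "e' \<in> edges G" "e = Inl ` e'" by blast
      then have "e' \<subseteq> S" using e(2) ST(1) by auto
      then show False using S(2) e'(1) by blast
    next
      assume "e \<in> {{Inl v, Inr (v, i)} | v i. v \<in> verts G \<and> i < q}"
      then show False using e(2) ST(1,3) by auto
    qed
  qed
  then show "F \<in> ?L" by simp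
qed

lemma sum_Pow_binomial:
  fixes a b :: "'r::comm_ring_1"
  assumes "finite W"
  shows "(\<Sum>T\<in>Pow W. a ^ card T * b ^ (card W - card T)) = (a + b) ^ card W"
proof -
  have "(a + b) ^ card W = (\<Prod>w\<in>W. a + b)" by simp
  also have "\<dots> = (\<Sum>T\<in>Pow W. (\<Prod>w\<in>T. a) * (\<Prod>w\<in>W - T. b))" by (rule prod_add[OF assms])
  also have "\<dots> = (\<Sum>T\<in>Pow W. a ^ card T * b ^ (card W - card T))"
    using assms by (intro sum.cong) (auto simp: card_Diff_subset finite_subset)
  finally show ?thesis ..
qed

text \<open>For fixed \<open>S\<close>, the free choice among the \<open>q (n - card S)\<close> whisker vertices not attached to \<open>S\<close> sums up to
  a power of \<open>a + b\<close>.  Both parts of the theorem substitute \<open>t\<close> and \<open>1 - t\<close> for \<open>a\<close> and \<open>b\<close>, in either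
  order, so that this power is 1.\<close>
lemma independence_polynomial_attach_whiskers:
  fixes a b :: "'r::comm_ring_1"
  assumes G: "finite_simple_graph G"
  defines "n \<equiv> card (verts G)"
  shows "(\<Sum>F | independent_set (attach_whiskers q G) F. a ^ card F * b ^ (n + n * q - card F))
    = (\<Sum>S | independent_set G S. a ^ card S * b ^ (n - card S + q * card S) * (a + b) ^ (q * (n - card S)))"
proof -
  have fin: "finite (verts G)" using G by (simp add: finite_simple_graph_def)
  have S: "S \<subseteq> verts G" "finite S" "card S \<le> n" if "independent_set G S" for S
    using that fin card_mono[OF fin] by (auto simp: independent_set_def n_def intro: finite_subset)
  have finS: "finite {S. independent_set G S}"
    by (rule finite_subset[of _ "Pow (verts G)"]) (use fin in \<open>auto simp: independent_set_def\<close>)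
  let ?W = "\<lambda>S. (verts G - S) \<times> {..<q}"
  have W: "card (?W S) = q * (n - card S)" "finite (?W S)" if "independent_set G S" for S
    using fin S[OF that] by (simp_all add: card_Diff_subset n_def mult.commute)
  have "(\<Sum>F | independent_set (attach_whiskers q G) F. a ^ card F * b ^ (n + n * q - card F))
      = (\<Sum>(S, T)\<in>(SIGMA S:{S. independent_set G S}. Pow (?W S)).
          a ^ card (S <+> T) * b ^ (n + n * q - card (S <+> T)))"
    unfolding independent_sets_attach_whiskers[OF G]
  proof (subst sum.reindex)
    show "inj_on (\<lambda>(S, T). S <+> T) (SIGMA S:{S. independent_set G S}. Pow (?W S))"
    proof (rule inj_on_inverseI)
      fix x assume "x \<in> (SIGMA S:{S. independent_set G S}. Pow (?W S))"
      show "(\<lambda>F. (Inl -` F, Inr -` F)) ((\<lambda>(S, T). S <+> T) x) = x"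
        by (cases x) auto
    qed
  qed (simp add: case_prod_unfold)
  also have "\<dots> = (\<Sum>S | independent_set G S. \<Sum>T\<in>Pow (?W S).
          a ^ card (S <+> T) * b ^ (n + n * q - card (S <+> T)))"
    using finS W by (subst sum.Sigma) auto
  also have "\<dots> = (\<Sum>S | independent_set G S. a ^ card S * b ^ (n - card S + q * card S) * (a + b) ^ (q * (n - card S)))"
  proof (rule sum.cong[OF refl])
    fix S assume "S \<in> {S. independent_set G S}"
    then have ind: "independent_set G S" by simp
    have "(\<Sum>T\<in>Pow (?W S). a ^ card (S <+> T) * b ^ (n + n * q - card (S <+> T)))
        = (\<Sum>T\<in>Pow (?W S). a ^ card S * b ^ (n - card S + q * card S) * (a ^ card T * b ^ (card (?W S) - card T)))"
    proof (rule sum.cong[OF refl])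
      fix T assume "T \<in> Pow (?W S)"
      then have T: "finite T" "card T \<le> card (?W S)" using W(2)[OF ind] by (auto intro: finite_subset card_mono)
      obtain j where j: "n = card S + j" using S(3)[OF ind] le_Suc_ex by blast
      have "n + n * q - card (S <+> T) = (n - card S + q * card S) + (card (?W S) - card T)"
        using T(2) unfolding W(1)[OF ind] card_Plus[OF S(2)[OF ind] T(1)] j by (simp add: algebra_simps)
      then show "a ^ card (S <+> T) * b ^ (n + n * q - card (S <+> T))
          = a ^ card S * b ^ (n - card S + q * card S) * (a ^ card T * b ^ (card (?W S) - card T))"
        using card_Plus[OF S(2)[OF ind] T(1)] by (simp add: power_add mult_ac)
    qed
    also have "\<dots> = a ^ card S * b ^ (n - card S + q * card S) * (a + b) ^ card (?W S)"
      by (simp only: sum_distrib_left[symmetric] sum_Pow_binomial[OF W(2)[OF ind]])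
    finally show "(\<Sum>T\<in>Pow (?W S). a ^ card (S <+> T) * b ^ (n + n * q - card (S <+> T)))
        = a ^ card S * b ^ (n - card S + q * card S) * (a + b) ^ (q * (n - card S))"
      unfolding W(1)[OF ind] .
  qed
  finally show ?thesis .
qed

section \<open>The degrees of the h-polynomials\<close>

text \<open>Since \<open>f k + g k\<close> increases with \<open>k\<close>, only the terms with the largest \<open>c S\<close> reach the top degree, and
  there they all have the same leading coefficient \<open>\<plusminus>1\<close>, so they cannot cancel.\<close>
lemma degree_sum_bernstein:
  fixes c :: "'s \<Rightarrow> nat" and f g :: "nat \<Rightarrow> nat"
  assumes "finite \<S>" "S0 \<in> \<S>" "c S0 = \<alpha>" and le: "\<And>S. S \<in> \<S> \<Longrightarrow> c S \<le> \<alpha>"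
    and fg: "\<And>k. k \<le> \<alpha> \<Longrightarrow> f k + g k = n + q * k" and q: "q \<ge> 1"
  shows "degree (\<Sum>S\<in>\<S>. [:0, 1 :: int:] ^ f (c S) * [:1, -1:] ^ g (c S)) = n + q * \<alpha>" (is "degree ?p = _")
proof (rule antisym)
  have top: "degree ([:0, 1 :: int:] ^ i * [:1, -1:] ^ j) = i + j" for i j
    by (simp add: degree_mult_eq degree_power_eq)
  have lead: "lead_coeff ([:0, 1 :: int:] ^ i * [:1, -1:] ^ j) = (-1) ^ j" for i j
    by (simp only: lead_coeff_mult lead_coeff_power) simp
  show "degree ?p \<le> n + q * \<alpha>"
    using le fg assms(1) by (intro degree_sum_le) (auto simp: top)
  have "coeff ([:0, 1 :: int:] ^ f (c S) * [:1, -1:] ^ g (c S)) (n + q * \<alpha>)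
      = (if c S = \<alpha> then (-1) ^ g \<alpha> else 0)" if "S \<in> \<S>" for S
  proof (cases "c S = \<alpha>")
    case True
    then show ?thesis using top[of "f \<alpha>" "g \<alpha>"] lead[of "f \<alpha>" "g \<alpha>"] fg[of \<alpha>] by simp
  next
    case False
    then have "c S < \<alpha>" using le[OF that] by simp
    then have "f (c S) + g (c S) < n + q * \<alpha>" using fg[of "c S"] q by simp
    then show ?thesis using False top[of "f (c S)" "g (c S)"] by (simp add: coeff_eq_0)
  qed
  then have "coeff ?p (n + q * \<alpha>) = (\<Sum>S\<in>\<S>. if c S = \<alpha> then (-1) ^ g \<alpha> else 0)"
    by (simp add: coeff_sum)
  also have "\<dots> = (-1) ^ g \<alpha> * int (card {S \<in> \<S>. c S = \<alpha>})"
    using assms(1) by (simp add: sum.If_cases Int_def)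
  also have "\<dots> \<noteq> 0" using assms(1-3) by auto
  finally show "n + q * \<alpha> \<le> degree ?p" by (rule le_degree)
qed

theorem theorem7p1:
  fixes G :: "'v sgraph" and n q :: nat
  assumes "finite_simple_graph G"
    and "card (verts G) = n" and "n \<ge> 1"
    and "q \<ge> 1"
  shows "Polynomial.degree
           (h_quot (verts (attach_whiskers q G))
             (edge_ideal (attach_whiskers q G) :: ('v + 'v \<times> nat, 'k::field) mpoly set))
           = q * independence_number G
       \<and> int (Polynomial.degree
           (h_quot (verts (attach_whiskers q G))
             (cover_ideal (attach_whiskers q G) :: ('v + 'v \<times> nat, 'k::field) mpoly set)))
           = int n - 2 + int q * int (independence_number G)"
proof -
  let ?H = "attach_whiskers q G" and ?X = "[:0, 1 :: int:]" and ?Y = "[:1, -1 :: int:]"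
  define \<alpha> where "\<alpha> = independence_number G"
  define N where "N = n + n * q"
  have XY: "?X + ?Y = 1" "?Y + ?X = 1" by simp_all
  have H: "finite_simple_graph ?H" by (rule finite_simple_attach_whiskers[OF assms(1)])
  have finG: "finite (verts G)" using assms(1) by (simp add: finite_simple_graph_def)
  have finH: "finite (verts ?H)" using H by (simp add: finite_simple_graph_def)
  have cardH: "card (verts ?H) = N"
    using finG assms(2) by (simp add: verts_attach_whiskers card_Plus N_def)
  have S: "finite S" "card S \<le> n" if "independent_set G S" for S
    using that finG card_mono[OF finG] assms(2) by (auto simp: independent_set_def intro: finite_subset)
  have finS: "finite {S. independent_set G S}"
    by (rule finite_subset[of _ "Pow (verts G)"]) (use finG in \<open>auto simp: independent_set_def\<close>)
  have "independent_set G {}" by (simp add: independent_set_def)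
  then have "\<alpha> \<in> card ` {S. independent_set G S}"
    unfolding \<alpha>_def independence_number_def using finS by (intro Max_in) auto
  then obtain S0 where S0: "independent_set G S0" "card S0 = \<alpha>" by auto
  have \<alpha>: "card S \<le> \<alpha>" if "independent_set G S" for S
    using finS that unfolding \<alpha>_def independence_number_def by (intro Max_ge) auto
  have \<alpha>n: "\<alpha> \<le> n" using S0 S(2) by blast
  obtain v where v: "v \<in> verts G" using assms(2,3) by fastforce
  have "{Inl v, Inr (v, 0)} \<in> edges ?H" using v assms(4) by (force simp: edges_attach_whiskers)

  have "degree (h_quot (verts ?H) (edge_ideal ?H :: ('v + 'v \<times> nat, 'k) mpoly set)) = q * \<alpha>" (is "degree ?h = _")
  proof -
    interpret simplicial_complex "verts ?H" "{F. independent_set ?H F}" by (rule edge_ideal_eq(1)[OF H])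
    have bound: "card F \<le> n * q" if "independent_set ?H F" for F
    proof -
      have "F \<in> (\<lambda>(S, T). S <+> T) ` (SIGMA S:{S. independent_set G S}. Pow ((verts G - S) \<times> {..<q}))"
        unfolding independent_sets_attach_whiskers[OF assms(1), symmetric] using that by simp
      then obtain S T where ST: "F = S <+> T" "independent_set G S" "T \<subseteq> (verts G - S) \<times> {..<q}"
        by auto
      have "card T \<le> (n - card S) * q"
        using card_mono[OF _ ST(3)] finG assms(2) ST(2) S(1)[OF ST(2)]
        by (simp add: card_Diff_subset independent_set_def)
      moreover have "finite T" using finite_subset[OF ST(3)] finG by simp
      moreover have "card S \<le> card S * q" using assms(4) by simp
      ultimately have "card F \<le> card S * q + (n - card S) * q"
        unfolding ST(1) by (simp only: card_Plus[OF S(1)[OF ST(2)]] add_mono)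
      then show ?thesis
        unfolding add_mult_distrib[symmetric] using S(2)[OF ST(2)] by simp
    qed
    have "{} <+> (verts G \<times> {..<q}) \<in> {F. independent_set ?H F}"
      unfolding independent_sets_attach_whiskers[OF assms(1)]
      using \<open>independent_set G {}\<close> by (intro image_eqI[of _ _ "({}, verts G \<times> {..<q})"]) auto
    moreover have "card ({} <+> (verts G \<times> {..<q}) :: ('v + 'v \<times> nat) set) = n * q"
      using finG assms(2) by (simp add: card_Plus)
    ultimately have h: "?h = (\<Sum>F | independent_set ?H F. ?X ^ card F * ?Y ^ (n * q - card F))"
      unfolding edge_ideal_eq(2)[OF H] by (rule h_quot_nonface_ideal) (use bound in auto)
    \<comment> \<open>The factor \<open>(1 - t)\<^sup>n\<close> completes the exponents to the number \<open>N\<close> of vertices, as the identity for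
      whiskered graphs requires.\<close>
    have "?h * ?Y ^ n = (\<Sum>F | independent_set ?H F. ?X ^ card F * ?Y ^ (N - card F))"
      unfolding h sum_distrib_right N_def
    proof (rule sum.cong[OF refl])
      fix F assume "F \<in> {F. independent_set ?H F}"
      then have "n + n * q - card F = (n * q - card F) + n" using bound by simp
      then show "?X ^ card F * ?Y ^ (n * q - card F) * ?Y ^ n = ?X ^ card F * ?Y ^ (n + n * q - card F)"
        by (simp only: power_add mult.assoc)
    qed
    also have "\<dots> = (\<Sum>S | independent_set G S. ?X ^ card S * ?Y ^ (n - card S + q * card S))"
      using independence_polynomial_attach_whiskers[OF assms(1), of ?X ?Y q]
      unfolding XY assms(2) N_def power_one mult_1_right .
    also have "degree \<dots> = n + q * \<alpha>"
      using finS S0 \<alpha> assms(4) \<alpha>n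
      by (intro degree_sum_bernstein[where f = "\<lambda>k. k" and g = "\<lambda>k. n - k + q * k"]) auto
    finally have deg: "degree (?h * ?Y ^ n) = n + q * \<alpha>" .
    then have "?h \<noteq> 0" using assms(3) by auto
    then show ?thesis using deg by (simp add: degree_mult_eq degree_power_eq)
  qed
  moreover have "degree (h_quot (verts ?H) (cover_ideal ?H :: ('v + 'v \<times> nat, 'k) mpoly set)) + 2 = n + q * \<alpha>"
    (is "degree ?h + 2 = _")
  proof -
    let ?\<Delta> = "{F. F \<subseteq> verts ?H \<and> \<not> independent_set ?H (verts ?H - F)}"
    have ne: "edges ?H \<noteq> {}" using \<open>{Inl v, Inr (v, 0)} \<in> edges ?H\<close> by blast
    interpret simplicial_complex "verts ?H" ?\<Delta> by (rule cover_ideal_eq(1)[OF H ne])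
    have bound: "card F + 2 \<le> N" if "F \<in> ?\<Delta>" for F
    proof -
      obtain e where e: "e \<in> edges ?H" "e \<subseteq> verts ?H - F"
        using \<open>F \<in> ?\<Delta>\<close> independent_set_iff[OF H] by blast
      have "2 = card e" using e(1) H by (simp add: finite_simple_graph_def)
      also have "\<dots> \<le> card (verts ?H - F)" using e(2) finH by (intro card_mono) auto
      also have "\<dots> = N - card F"
        using that finH cardH finite_subset[OF _ finH, of F] by (simp add: card_Diff_subset)
      finally show ?thesis by simp
    qed
    let ?e = "{Inl v, Inr (v, 0)} :: ('v + 'v \<times> nat) set"
    have sub: "?e \<subseteq> verts ?H" using v assms(4) by (auto simp: verts_attach_whiskers)
    then have "verts ?H - (verts ?H - ?e) = ?e" by blast
    then have "verts ?H - ?e \<in> ?\<Delta>"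
      using \<open>?e \<in> edges ?H\<close> independent_set_iff[OF H, of ?e] by auto
    moreover have "card (verts ?H - ?e) = N - 2" using sub finH cardH by (simp add: card_Diff_subset)
    moreover have "card F \<le> N - 2" if "F \<in> ?\<Delta>" for F using bound[OF that] by simp
    ultimately have h: "?h = (\<Sum>F\<in>?\<Delta>. ?X ^ card F * ?Y ^ (N - 2 - card F))"
      unfolding cover_ideal_eq(2)[OF H ne] by (rule h_quot_nonface_ideal)
    let ?P = "\<Sum>S | independent_set G S. ?X ^ (n - card S + q * card S) * ?Y ^ card S"
    \<comment> \<open>Complementation turns the sum over faces into the sum over all sets, which is 1, minus a sum
      over independent sets with the roles of \<open>t\<close> and \<open>1 - t\<close> exchanged.\<close>
    have "?h * ?Y ^ 2 = (\<Sum>F\<in>?\<Delta>. ?X ^ card F * ?Y ^ (N - card F))"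
      unfolding h sum_distrib_right
    proof (rule sum.cong[OF refl])
      fix F assume "F \<in> ?\<Delta>"
      then have "N - card F = (N - 2 - card F) + 2" using bound[of F] by simp
      then show "?X ^ card F * ?Y ^ (N - 2 - card F) * ?Y ^ 2 = ?X ^ card F * ?Y ^ (N - card F)"
        by (simp only: power_add mult.assoc)
    qed
    also have "\<dots> = (\<Sum>F\<in>Pow (verts ?H). ?X ^ card F * ?Y ^ (N - card F))
        - (\<Sum>F\<in>Pow (verts ?H) - ?\<Delta>. ?X ^ card F * ?Y ^ (N - card F))"
      using finH by (subst sum_diff) auto
    also have "(\<Sum>F\<in>Pow (verts ?H). ?X ^ card F * ?Y ^ (N - card F)) = 1"
      using sum_Pow_binomial[OF finH, of ?X ?Y] unfolding cardH XY power_one .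
    also have "(\<Sum>F\<in>Pow (verts ?H) - ?\<Delta>. ?X ^ card F * ?Y ^ (N - card F))
        = (\<Sum>F | independent_set ?H F. ?Y ^ card F * ?X ^ (N - card F))"
    proof (rule sum.reindex_bij_witness[of _ "\<lambda>F. verts ?H - F" "\<lambda>F. verts ?H - F"])
      fix F assume F: "F \<in> Pow (verts ?H) - ?\<Delta>"
      have "card (verts ?H - F) = N - card F" "card F \<le> N"
        using F finH cardH card_mono[OF finH, of F] by (auto simp: card_Diff_subset finite_subset)
      then show "?Y ^ card (verts ?H - F) * ?X ^ (N - card (verts ?H - F)) = ?X ^ card F * ?Y ^ (N - card F)"
        by (simp add: mult.commute)
    qed (auto simp: independent_set_def double_diff)
    also have "\<dots> = (\<Sum>S | independent_set G S. ?Y ^ card S * ?X ^ (n - card S + q * card S))"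
      using independence_polynomial_attach_whiskers[OF assms(1), of ?Y ?X q]
      unfolding XY assms(2) N_def power_one mult_1_right .
    also have "\<dots> = ?P" by (simp only: mult.commute)
    finally have eq: "?h * ?Y ^ 2 = 1 - ?P" .
    have P: "degree ?P = n + q * \<alpha>"
      using finS S0 \<alpha> assms(4) \<alpha>n
      by (intro degree_sum_bernstein[where f = "\<lambda>k. n - k + q * k" and g = "\<lambda>k. k"]) auto
    \<comment> \<open>The constant 1 does not disturb the leading term because \<open>n \<ge> 1\<close>.\<close>
    have "degree (- ?P + 1) = degree (- ?P)"
      using P assms(3) by (intro degree_add_eq_left) simp
    then have deg: "degree (?h * ?Y ^ 2) = n + q * \<alpha>" using P eq by simp
    then have "?h \<noteq> 0" using assms(3) by auto
    then show ?thesis using deg by (simp add: degree_mult_eq degree_power_eq)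
  qed
  ultimately show ?thesis
    unfolding \<alpha>_def[symmetric] of_nat_mult[symmetric] by (intro conjI) linarith+
qed

end
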